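(* (Partial variational principle) Let $m\ge1$, let $(X,d)$ be a compact metric space, let $f_i:X\to X$ ($i=0,\dots,m-1$) be continuous maps such that $\mathscr{M}(X,f_0,\dots,f_{m-1})\ne\emptyset$, and let $\varphi\in C(X,\mathbb{R})$. Then \[\sup\left\{h_\mu(f_0,\dots,f_{m-1})+\int\varphi\,d\mu\;\Big|\;\mu\in\mathscr{M}(X,f_0,\dots,f_{m-1})\right\}\le P(f_0,\dots,f_{m-1},\varphi).\] In particular, for $\varphi=0$, \[\sup\{h_\mu(f_0,\dots,f_{m-1})\mid\mu\in\mathscr{M}(X,f_0,\dots,f_{m-1})\}\le h(f_0,\dots,f_{m-1}).\]
   Context: $C(X,\mathbb{R})$ is the space of real-valued continuous functions on $X$. $\mathscr{M}(X,f_0,\dots,f_{m-1})$ is the set of Borel probability measures $\mu$ on $X$ with $\mu(f_i^{-1}A)=\mu(A)$ for all Borel $A$ and all $i=0,\dots,m-1$. Words. $F_m^+$ is the set of finite words in the symbols $0,1,\dots,m-1$; $|w|$ is the length of $w$. Write $w'\le w$ if $w=w''w'$ for some nonempty word $w''$, where $w'$ may be empty; thus if $|w|=n$, the words $w'\le w$ are the $n$ suffixes of $w$ of lengths $0,1,\dots,n-1$. For $w=w_1w_2\cdots w_k$ put $f_w=f_{w_1}\circ f_{w_2}\circ\cdots\circ f_{w_k}$, with $f_w=\mathrm{id}$ for the empty word; $f_w^{-1}$ denotes preimage. Pressure and topological entropy. Let $d_w(x,y)=\max_{w'\le w}d(f_{w'}(x),f_{w'}(y))$ and $(S_w\varphi)(x)=\sum_{w'\le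 w}\varphi(f_{w'}(x))$. A set $E\subset X$ is $(w,\varepsilon,f_0,\dots,f_{m-1})$-spanning if for every $x\in X$ there is $y\in E$ with $d_w(x,y)<\varepsilon$. Put $Q_w(f_0,\dots,f_{m-1},\varphi,\varepsilon)=\inf\{\sum_{x\in E}e^{(S_w\varphi)(x)}: E \text{ is } (w,\varepsilon,f_0,\dots,f_{m-1})\text{-spanning}\}$, $Q_n(f_0,\dots,f_{m-1},\varphi,\varepsilon)=\frac1{m^n}\sum_{|w|=n}Q_w(f_0,\dots,f_{m-1},\varphi,\varepsilon)$ and $P(f_0,\dots,f_{m-1},\varphi)=\lim_{\varepsilon\to0}\limsup_{n\to\infty}\frac1n\log Q_n(f_0,\dots,f_{m-1},\varphi,\varepsilon)\in(-\infty,\infty]$. The topological entropy is $h(f_0,\dots,f_{m-1})=\lim_{\varepsilon\to0}\limsup_{n\to\infty}\frac1n\log\big(\frac1{m^n}\sum_{|w|=n}B(w,\varepsilon,f_0,\dots,f_{m-1})\big)$, where $B(w,\varepsilon,f_0,\dots,f_{m-1})$ is the minimal cardinality of a $(w,\varepsilon,f_0,\dots,f_{m-1})$-spanning set. Measure-theoretic entropy. For a finite measurable partition $\xi=\{A_1,\dots,A_k\}$, $H_\mu(\xi)=-\sum_i\mu(A_i)\log\mu(A_i)$ (with $0\log0=0$); $\xi\vee\eta$ is the partition into intersections $A\cap C$, $A\in\xi$, $C\in\eta$; $f^{-1}\xi=\{f^{-1}A:A\in\xi\}$. For $\mu$ invariant under all $f_i$, $h_\mu(f_0,\dots,f_{m-1},\xi)=\lim_{n\to\infty}\frac1n\Big[\frac1{m^n}\sum_{|w|=n}H_\mu\big(\bigvee_{w'\le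 w}f_{w'}^{-1}\xi\big)\Big]$ (this limit exists), and $h_\mu(f_0,\dots,f_{m-1})=\sup_\xi h_\mu(f_0,\dots,f_{m-1},\xi)$ over all finite measurable partitions $\xi$. *)

theory Defs
  imports "HOL-Analysis.Analysis" "HOL-Probability.Probability" "HOL-Library.Sublist"
    "HOL-Library.Disjoint_Sets"
begin

text \<open>
  The compact metric space is a compact subset \<open>X\<close> of a type of class \<open>metric_space\<close>, with metric
  \<open>dist\<close>; the semigroup is given by maps \<open>f i\<close>, \<open>i < m\<close>, of which only the restriction to \<open>X\<close>
  matters. Words are lists over \<open>{..<m}\<close>, and the relation \<open>w' \<le> w\<close> of the paper (with a nonempty
  complementary prefix) is the library's \<open>strict_suffix w' w\<close>.
\<close>

definition words :: "nat \<Rightarrow> nat \<Rightarrow> nat list set" where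
  "words m n = {w. set w \<subseteq> {..<m} \<and> length w = n}"

primrec word_map :: "(nat \<Rightarrow> 'a \<Rightarrow> 'a) \<Rightarrow> nat list \<Rightarrow> 'a \<Rightarrow> 'a" where
  "word_map f [] = id"
| "word_map f (i # w) = f i \<circ> word_map f w"

text \<open>For the empty word this is an unspecified \<open>Max {}\<close>; it enters the asymptotic quantities below
  only through their term at \<open>n = 0\<close>.\<close>

definition word_dist :: "(nat \<Rightarrow> 'a::metric_space \<Rightarrow> 'a) \<Rightarrow> nat list \<Rightarrow> 'a \<Rightarrow> 'a \<Rightarrow> real" where
  "word_dist f w x y = Max ((\<lambda>w'. dist (word_map f w' x) (word_map f w' y)) ` {w'. strict_suffix w' w})"

definition word_sum :: "(nat \<Rightarrow> 'a \<Rightarrow> 'a) \<Rightarrow> nat list \<Rightarrow> ('a \<Rightarrow> real) \<Rightarrow> 'a \<Rightarrow> real" where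
  "word_sum f w \<phi> x = (\<Sum>w' | strict_suffix w' w. \<phi> (word_map f w' x))"

definition spanning ::
  "'a::metric_space set \<Rightarrow> (nat \<Rightarrow> 'a \<Rightarrow> 'a) \<Rightarrow> nat list \<Rightarrow> real \<Rightarrow> 'a set \<Rightarrow> bool" where
  "spanning X f w \<epsilon> E \<longleftrightarrow> E \<subseteq> X \<and> (\<forall>x\<in>X. \<exists>y\<in>E. word_dist f w x y < \<epsilon>)"

text \<open>Spanning sets may be infinite. The sum is therefore an unordered sum in \<^typ>\<open>ennreal\<close>, so that
  an infinite sum of this kind can take the value \<open>\<infinity>\<close> (a finite sum over an infinite index set
  would be \<open>0\<close>).\<close>

definition Q_word ::
  "'a::metric_space set \<Rightarrow> (nat \<Rightarrow> 'a \<Rightarrow> 'a) \<Rightarrow> ('a \<Rightarrow> real) \<Rightarrow> real \<Rightarrow> nat list \<Rightarrow> ennreal" where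
  "Q_word X f \<phi> \<epsilon> w =
     (INF E \<in> {E. spanning X f w \<epsilon> E}. \<Sum>\<^sub>\<infinity>x\<in>E. ennreal (exp (word_sum f w \<phi> x)))"

definition Q_level ::
  "'a::metric_space set \<Rightarrow> nat \<Rightarrow> (nat \<Rightarrow> 'a \<Rightarrow> 'a) \<Rightarrow> ('a \<Rightarrow> real) \<Rightarrow> real \<Rightarrow> nat \<Rightarrow> ennreal" where
  "Q_level X m f \<phi> \<epsilon> n = (\<Sum>w\<in>words m n. Q_word X f \<phi> \<epsilon> w) / of_nat (m ^ n)"

definition ln_ennreal :: "ennreal \<Rightarrow> ereal" where
  "ln_ennreal q = (if q = 0 then -\<infinity> else if q = \<infinity> then \<infinity> else ereal (ln (enn2real q)))"

definition pressure ::
  "'a::metric_space set \<Rightarrow> nat \<Rightarrow> (nat \<Rightarrow> 'a \<Rightarrow> 'a) \<Rightarrow> ('a \<Rightarrow> real) \<Rightarrow> ereal" where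
  "pressure X m f \<phi> =
     Lim (at_right 0) (\<lambda>\<epsilon>. limsup (\<lambda>n. ereal (1 / real n) * ln_ennreal (Q_level X m f \<phi> \<epsilon> n)))"

text \<open>By compactness and continuity there are finite spanning sets, so the minimal cardinality is
  attained among these; \<open>finite E\<close> is needed because \<open>card\<close> is \<open>0\<close> on infinite sets.\<close>

definition min_spanning ::
  "'a::metric_space set \<Rightarrow> (nat \<Rightarrow> 'a \<Rightarrow> 'a) \<Rightarrow> real \<Rightarrow> nat list \<Rightarrow> nat" where
  "min_spanning X f \<epsilon> w = (LEAST k. \<exists>E. finite E \<and> spanning X f w \<epsilon> E \<and> card E = k)"

definition topological_entropy ::
  "'a::metric_space set \<Rightarrow> nat \<Rightarrow> (nat \<Rightarrow> 'a \<Rightarrow> 'a) \<Rightarrow> ereal" where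
  "topological_entropy X m f =
     Lim (at_right 0) (\<lambda>\<epsilon>. limsup (\<lambda>n.
       ereal (1 / real n * ln (1 / real (m ^ n) * (\<Sum>w\<in>words m n. real (min_spanning X f \<epsilon> w))))))"

definition invariant_measures ::
  "'a::metric_space set \<Rightarrow> nat \<Rightarrow> (nat \<Rightarrow> 'a \<Rightarrow> 'a) \<Rightarrow> 'a measure set" where
  "invariant_measures X m f =
     {\<mu>. prob_space \<mu> \<and> sets \<mu> = sets (restrict_space borel X) \<and>
         (\<forall>i<m. \<forall>A\<in>sets \<mu>. measure \<mu> (f i -` A \<inter> X) = measure \<mu> A)}"

definition finite_partitions :: "'a measure \<Rightarrow> 'a set set set" where
  "finite_partitions \<mu> = {\<xi>. finite \<xi> \<and> \<xi> \<subseteq> sets \<mu> \<and> partition_on (space \<mu>) \<xi>}"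

text \<open>Since \<^term>\<open>ln (0::real) = 0\<close>, the convention \<open>0 log 0 = 0\<close> holds.\<close>

definition partition_entropy :: "'a measure \<Rightarrow> 'a set set \<Rightarrow> real" where
  "partition_entropy \<mu> \<xi> = - (\<Sum>A\<in>\<xi>. measure \<mu> A * ln (measure \<mu> A))"

definition preimage_partition :: "'a set \<Rightarrow> ('a \<Rightarrow> 'a) \<Rightarrow> 'a set set \<Rightarrow> 'a set set" where
  "preimage_partition X g \<xi> = (\<lambda>A. g -` A \<inter> X) ` \<xi>"

text \<open>The join over all \<open>w' \<le> w\<close> is the library's \<^const>\<open>common_refinement\<close>, whose members are the
  nonempty intersections obtained by choosing one cell from each of the partitions.\<close>

definition word_join :: "'a set \<Rightarrow> (nat \<Rightarrow> 'a \<Rightarrow> 'a) \<Rightarrow> 'a set set \<Rightarrow> nat list \<Rightarrow> 'a set set" where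
  "word_join X f \<xi> w =
     common_refinement ((\<lambda>w'. preimage_partition X (word_map f w') \<xi>) ` {w'. strict_suffix w' w})"

definition measure_entropy_wrt ::
  "'a measure \<Rightarrow> nat \<Rightarrow> (nat \<Rightarrow> 'a \<Rightarrow> 'a) \<Rightarrow> 'a set set \<Rightarrow> real" where
  "measure_entropy_wrt \<mu> m f \<xi> =
     lim (\<lambda>n. 1 / real n *
       (1 / real (m ^ n) * (\<Sum>w\<in>words m n. partition_entropy \<mu> (word_join (space \<mu>) f \<xi> w))))"

definition measure_entropy :: "'a measure \<Rightarrow> nat \<Rightarrow> (nat \<Rightarrow> 'a \<Rightarrow> 'a) \<Rightarrow> ereal" where
  "measure_entropy \<mu> m f = (SUP \<xi> \<in> finite_partitions \<mu>. ereal (measure_entropy_wrt \<mu> m f \<xi>))"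

end

theory Submission
  imports Defs
begin

text \<open>
  Fix an invariant measure \<open>\<mu>\<close> and a finite partition \<open>\<xi>\<close>. Along a word \<open>w\<close> each point has an itinerary, the
  list of cells of \<open>\<xi>\<close> that it visits, and the entropy of the join over the proper suffixes of \<open>w\<close> is the
  entropy \<open>H(w)\<close> of the random itinerary. By Gibbs' inequality, \<open>H(w)\<close> is at most the mean code length
  \<open>\<integral> - ln Q(itinerary of x) d\<mu>\<close> for any weights \<open>Q\<close> on itineraries, plus the logarithm of the total mass of
  \<open>Q\<close>. So it is enough to find, for each spanning set \<open>E\<close>, weights that describe itineraries cheaply in
  terms of the points of \<open>E\<close>.

  Cut \<open>w\<close> into \<open>q\<close> blocks of a fixed length \<open>N\<close>, and replace each set of points with a given itinerary
  along a block by a compact subset of almost the same measure. There are finitely many of these sets, and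
  for a given block they are at positive distance from each other, so for small \<open>\<epsilon>\<close> an \<open>\<epsilon>\<close>-ball meets at
  most one of them. Therefore, if \<open>y \<in> E\<close> is \<open>\<epsilon>\<close>-close to \<open>x\<close> along \<open>w\<close>, the orbit of \<open>y\<close> determines each block
  of the itinerary of \<open>x\<close> unless \<open>x\<close> is outside of the compact sets at the start of that block. Paying
  \<open>ln 2\<close> per block for telling these two cases apart and a uniform code for the block in the second case,
  which by invariance costs at most \<open>1\<close> per block on average, and giving \<open>y\<close> the weight \<open>exp (S\<^sub>w \<phi> y)\<close>,
  one arrives at
  \<open>H(w) + \<bar>w\<bar> \<integral> \<phi> d\<mu> \<le> ln (\<Sum>y\<in>E. exp (S\<^sub>w \<phi> y)) + \<bar>w\<bar> \<tau> + q (1 + ln 2)\<close>,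
  where \<open>\<tau>\<close> bounds the oscillation of \<open>\<phi>\<close> at scale \<open>\<epsilon>\<close>; this is \<open>entropy_along_le_spanning\<close>. Averaging over
  the words of length \<open>q N\<close> with Jensen's inequality and letting \<open>q\<close> tend to infinity bounds the pressure at
  scale \<open>\<epsilon>\<close> from below with an error \<open>\<tau> + (1 + ln 2) / N\<close> (\<open>pressure_at_scale_ge\<close>). As \<open>N\<close> can be chosen large
  and then \<open>\<epsilon>\<close> small, the error disappears. Working with blocks from the start replaces the passage
  to iterates of a single map, which would make the potential depend on the word.

  Two facts that these estimates rest on are subadditivity of the entropy (\<open>entropy_along_append\<close>), which
  makes the entropy of the partition a genuine limit, and inner regularity of finite Borel measures on
  the compact space (\<open>compact_inner_approximation\<close>). The second assertion is the case \<open>\<phi> = 0\<close>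
  (\<open>topological_entropy_eq_pressure_zero\<close>).
\<close>

section \<open>Sums over words and averages\<close>

lemma sum_lists_append:
  fixes F :: "'b list \<Rightarrow> 'c::comm_monoid_add"
  shows "(\<Sum>s | set s \<subseteq> A \<and> length s = k + n. F s) =
    (\<Sum>a | set a \<subseteq> A \<and> length a = k. \<Sum>b | set b \<subseteq> A \<and> length b = n. F (a @ b))"
proof -
  let ?L = "\<lambda>n. {s. set s \<subseteq> A \<and> length s = n}"
  have "bij_betw (\<lambda>(a, b). a @ b) (?L k \<times> ?L n) (?L (k + n))"
    by (rule bij_betw_byWitness[where f' = "\<lambda>s. (take k s, drop k s)"])
      (auto dest: in_set_takeD in_set_dropD)
  from sum.reindex_bij_betw[OF this, of F] show ?thesis
    by (simp add: sum.cartesian_product case_prod_unfold)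
qed

lemma finite_words [simp]: "finite (words m n)"
  unfolding words_def by (rule finite_lists_length_eq) simp

lemma card_words: "card (words m n) = m ^ n"
  unfolding words_def by (subst card_lists_length_eq) auto

lemma sum_words_append:
  fixes F :: "nat list \<Rightarrow> 'c::comm_monoid_add"
  shows "(\<Sum>w\<in>words m (k + n). F w) = (\<Sum>u\<in>words m k. \<Sum>v\<in>words m n. F (u @ v))"
  unfolding words_def by (rule sum_lists_append)

section \<open>Gibbs and Jensen inequalities\<close>

text \<open>
  This is concavity of the logarithm, used in the form \<open>ln t \<le> t - 1\<close>. Every upper bound for an entropy
  below is one application of it, with weights \<open>q\<close> made for the purpose; the weights are not
  normalised, so that their total mass \<open>Z\<close> appears as \<open>ln Z\<close> in the bound. Weights may vanish where \<open>p\<close>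
  does, which occurs for products of marginals.
\<close>

lemma gibbs_inequality:
  fixes p q :: "'b \<Rightarrow> real"
  assumes p: "\<And>i. i \<in> I \<Longrightarrow> 0 \<le> p i" and q: "\<And>i. i \<in> I \<Longrightarrow> 0 \<le> q i"
    and pq: "\<And>i. i \<in> I \<Longrightarrow> q i = 0 \<Longrightarrow> p i = 0"
    and p1: "sum p I = 1" and Z: "sum q I \<le> Z"
  shows "- (\<Sum>i\<in>I. p i * ln (p i)) \<le> ln Z - (\<Sum>i\<in>I. p i * ln (q i))"
proof -
  have fin: "finite I" using p1 by (metis sum.infinite zero_neq_one)
  obtain i0 where "i0 \<in> I" "p i0 \<noteq> 0" using p1 by (metis sum.neutral zero_neq_one)
  then have "0 < sum q I"
    using pq q fin by (metis less_eq_real_def sum_pos2)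
  then have Z0: "Z > 0" using Z by simp
  have "p i * ln (q i) - p i * ln (p i) - p i * ln Z \<le> q i / Z - p i" if "i \<in> I" for i
  proof (cases "p i = 0")
    case True
    then show ?thesis using q[OF that] Z0 by simp
  next
    case False
    then have pos: "p i > 0" "q i > 0" using p[OF that] q[OF that] pq[OF that] by force+
    have "p i * ln (q i) - p i * ln (p i) - p i * ln Z = p i * ln (q i / (Z * p i))"
      using pos Z0 by (simp add: ln_div ln_mult algebra_simps)
    also have "\<dots> \<le> p i * (q i / (Z * p i) - 1)"
      using pos Z0 by (intro mult_left_mono ln_le_minus_one) auto
    also have "\<dots> = q i / Z - p i" using pos Z0 by (simp add: field_simps)
    finally show ?thesis .
  qed
  then have "(\<Sum>i\<in>I. p i * ln (q i) - p i * ln (p i) - p i * ln Z) \<le> (\<Sum>i\<in>I. q i / Z - p i)"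
    by (rule sum_mono)
  also have "\<dots> = sum q I / Z - 1"
    by (simp add: sum_subtractf sum_divide_distrib p1)
  also have "\<dots> \<le> 0" using Z Z0 by simp
  finally show ?thesis
    by (simp add: sum_subtractf p1 flip: sum_distrib_right)
qed

text \<open>
  Jensen's inequality for \<open>exp\<close>. It turns lower bounds for the individual words into one for the
  logarithm of their average, which is where the pressure takes the average.
\<close>

lemma exp_average_le:
  fixes L :: "'b \<Rightarrow> real"
  assumes "finite I" "I \<noteq> {}"
  shows "exp (sum L I / card I) \<le> (\<Sum>i\<in>I. exp (L i)) / card I"
proof -
  define c where "c = sum L I / card I"
  have n: "real (card I) > 0" using assms by (simp add: card_gt_0_iff)
  \<comment> \<open>The tangent of \<open>exp\<close> at the mean \<open>c\<close> lies below the graph.\<close>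
  have "exp c * (1 + (L i - c)) \<le> exp (L i)" for i
  proof -
    have "exp c * (1 + (L i - c)) \<le> exp c * exp (L i - c)"
      by (intro mult_left_mono exp_ge_add_one_self) auto
    then show ?thesis by (simp flip: exp_add)
  qed
  then have "(\<Sum>i\<in>I. exp c * (1 + (L i - c))) \<le> (\<Sum>i\<in>I. exp (L i))"
    by (rule sum_mono)
  moreover have "(\<Sum>i\<in>I. exp c * (1 + (L i - c))) = exp c * card I"
    using n by (simp add: sum.distrib sum_subtractf c_def flip: sum_distrib_left)
  ultimately show ?thesis using n by (simp add: c_def field_simps)
qed

section \<open>Subadditive sequences\<close>

text \<open>
  Fekete's lemma: the limit is \<open>L = inf a n / n\<close>, since with \<open>n = q k + r\<close> and \<open>r < k\<close> the quotient \<open>a n / n\<close>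
  exceeds \<open>a k / k\<close> by at most a bounded quantity divided by \<open>n\<close>.
\<close>

lemma subadditive_nonneg_convergent:
  fixes a :: "nat \<Rightarrow> real"
  assumes sub: "\<And>n k. a (n + k) \<le> a n + a k" and nonneg: "\<And>n. 0 \<le> a n"
  shows "convergent (\<lambda>n. a n / n)"
proof -
  define L where "L = (INF n\<in>{1..}. a n / real n)"
  have bdd: "bdd_below ((\<lambda>n. a n / real n) ` {1..})"
    by (rule bdd_belowI[of _ 0]) (auto simp: nonneg)
  have mult: "a (q * k) \<le> q * a k" if "q \<ge> 1" for q k
    using that
  proof (induction q rule: dec_induct)
    case (step q)
    then show ?case using sub[of k "q * k"] by (simp add: algebra_simps)
  qed simp
  have "(\<lambda>n. a n / n) \<longlonglongrightarrow> L"
  proof (rule order_tendstoI)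
    fix l assume "l < L"
    moreover have "L \<le> a n / n" if "n \<ge> 1" for n
      unfolding L_def using that bdd by (intro cINF_lower) auto
    ultimately show "\<forall>\<^sub>F n in sequentially. l < a n / n"
      by (intro eventually_sequentiallyI[of 1]) fastforce
  next
    fix u assume u: "L < u"
    then obtain k where k: "k \<ge> 1" "a k / k < u"
      using cINF_less_iff[OF _ bdd, of u] unfolding L_def by auto
    define e where "e = u - a k / k"
    have e: "e > 0" using k by (simp add: e_def)
    define M where "M = (\<Sum>r<k. a r) + a k"
    obtain n0 :: nat where n0: "M / e < n0" using reals_Archimedean2 by blast
    show "\<forall>\<^sub>F n in sequentially. a n / n < u"
    proof (rule eventually_sequentiallyI[of "max k (max 1 n0)"])
      fix n assume "max k (max 1 n0) \<le> n"
      then have n: "n \<ge> k" "n \<ge> 1" "n \<ge> n0" by auto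
      define q r where "q = n div k" and "r = n mod k"
      have q: "q \<ge> 1" and r: "r < k" and nqr: "n = q * k + r"
        using n k by (auto simp: q_def r_def div_greater_zero_iff Suc_le_eq)
      have "a r \<le> (\<Sum>r<k. a r)" using r nonneg by (intro member_le_sum) auto
      then have "a n \<le> q * a k + M"
        using sub[of "q * k" r] mult[OF q, of k] nonneg[of k] unfolding nqr M_def by linarith
      moreover have "q * a k \<le> n * (a k / k)"
      proof -
        have "real (q * k) * (a k / k) \<le> n * (a k / k)"
          using nonneg[of k] nqr by (intro mult_right_mono) auto
        then show ?thesis using k by simp
      qed
      moreover have "M < n * e"
      proof -
        have "M / e < n" using n0 n by linarith
        then show ?thesis using e by (simp add: field_simps)
      qed
      ultimately have "a n < n * (a k / k) + n * e" by linarith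
      also have "\<dots> = n * u" by (simp add: e_def algebra_simps)
      finally show "a n / n < u" using n by (simp add: field_simps)
    qed
  qed
  then show ?thesis by (rule convergentI)
qed

section \<open>Inner regularity of finite Borel measures\<close>

text \<open>
  The closed sets of points at distance at least \<open>1 / (n + 1)\<close> from the complement exhaust \<open>U\<close>.
\<close>

lemma open_inner_closed:
  fixes M :: "'a::metric_space measure"
  assumes "finite_measure M" and borel: "sets M = sets borel" and U: "open U" and e: "e > 0"
  shows "\<exists>F. closed F \<and> F \<subseteq> U \<and> measure M (U - F) < e"
proof (cases "U = UNIV")
  case True
  then show ?thesis using e by (intro exI[of _ UNIV]) auto
next
  case False
  interpret finite_measure M by fact
  have meas: "A \<in> sets M" if "closed A \<or> open A" for A
    unfolding borel using that by (elim disjE) (rule borel_closed borel_open, assumption)+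
  define F where "F n = {x. 1 / real (Suc n) \<le> infdist x (- U)}" for n
  have cl: "closed (F n)" for n
    unfolding F_def by (intro closed_Collect_le continuous_intros)
  have Fsub: "F n \<subseteq> U" for n
    unfolding F_def using infdist_zero by (force dest: ComplI)
  have "incseq F"
  proof (rule incseq_SucI)
    fix n
    have "1 / real (Suc (Suc n)) \<le> 1 / real (Suc n)" by (rule frac_le) auto
    then show "F n \<subseteq> F (Suc n)" unfolding F_def by (metis Collect_mono order_trans)
  qed
  moreover have "(\<Union>n. F n) = U"
  proof -
    have "\<exists>n. x \<in> F n" if "x \<in> U" for x
    proof -
      have "infdist x (- U) \<noteq> 0"
        using in_closed_iff_infdist_zero[of "- U" x] False U that by auto
      then have "infdist x (- U) > 0" using infdist_nonneg[of x "- U"] by linarith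
      then obtain n where "1 / real (Suc n) < infdist x (- U)"
        by (meson nat_approx_posE)
      then show ?thesis by (auto simp: F_def intro!: exI[of _ n])
    qed
    then show ?thesis using Fsub by blast
  qed
  ultimately have "(\<lambda>n. measure M (F n)) \<longlonglongrightarrow> measure M U"
    using finite_Lim_measure_incseq[of F] meas cl by (auto simp: image_subset_iff)
  then have "\<forall>\<^sub>F n in sequentially. measure M U - e < measure M (F n)"
    using e by (intro order_tendstoD) auto
  then obtain n where "measure M U - e < measure M (F n)"
    using eventually_sequentially by auto
  moreover have "measure M (U - F n) = measure M U - measure M (F n)"
    using finite_measure_Diff meas cl U Fsub by auto
  ultimately show ?thesis using cl Fsub by (intro exI[of _ "F n"]) auto
qed

text \<open>
  Inner approximation alone is not visibly stable under complements. Sets that are squeezed between a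
  closed and an open set of almost the same measure do form a \<open>\<sigma>\<close>-algebra, and it contains the open sets.
\<close>

lemma borel_squeeze_closed_open:
  fixes M :: "'a::metric_space measure"
  assumes fm: "finite_measure M" and borel: "sets M = sets borel" and A: "A \<in> sets borel"
  shows "\<forall>e>0. \<exists>F U. closed F \<and> open U \<and> F \<subseteq> A \<and> A \<subseteq> U \<and> measure M (U - F) < e"
proof -
  interpret finite_measure M by fact
  have meas: "A \<in> sets M" if "closed A \<or> open A" for A
    unfolding borel using that by (elim disjE) (rule borel_closed borel_open, assumption)+
  have "A \<in> sigma_sets UNIV {S. open S}" using A by (simp add: borel_def)
  then show ?thesis
  proof (induction rule: sigma_sets.induct)
    case (Basic A)
    then have opn: "open A" by simp
    show ?case
    proof (intro allI impI)
      fix e :: real assume "e > 0"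
      from open_inner_closed[OF fm borel opn this] obtain F
        where "closed F" "F \<subseteq> A" "measure M (A - F) < e" by auto
      with opn have "closed F \<and> open A \<and> F \<subseteq> A \<and> A \<subseteq> A \<and> measure M (A - F) < e"
        by simp
      then show "\<exists>F U. closed F \<and> open U \<and> F \<subseteq> A \<and> A \<subseteq> U \<and> measure M (U - F) < e"
        by (intro exI)
    qed
  next
    case Empty
    show ?case
      by (intro allI impI, rule exI[of _ "{}"], rule exI[of _ "{}"]) simp
  next
    case (Compl A)
    show ?case
    proof (intro allI impI)
      fix e :: real assume "e > 0"
      with Compl.IH obtain F U
        where "closed F" "open U" "F \<subseteq> A" "A \<subseteq> U" "measure M (U - F) < e"
        by metis
      moreover have "- F - - U = U - F" by auto
      ultimately have "closed (- U) \<and> open (- F) \<and> - U \<subseteq> UNIV - A \<and> UNIV - A \<subseteq> - F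
          \<and> measure M (- F - - U) < e"
        by auto
      then show "\<exists>F U. closed F \<and> open U \<and> F \<subseteq> UNIV - A \<and> UNIV - A \<subseteq> U \<and> measure M (U - F) < e"
        by (intro exI)
    qed
  next
    case (Union A)
    show ?case
    proof (intro allI impI)
      fix e :: real assume e: "e > 0"
      \<comment> \<open>The errors of the individual sets add up to \<open>e / 2\<close>; the other half is spent on replacing the
        union of the closed sets by a finite one, since only finite unions stay closed.\<close>
      define \<delta> where "\<delta> i = e / 4 * (1 / 2) ^ i" for i :: nat
      have \<delta>_pos: "\<delta> i > 0" for i using e by (simp add: \<delta>_def)
      have "\<forall>i. \<exists>F U. closed F \<and> open U \<and> F \<subseteq> A i \<and> A i \<subseteq> U \<and> measure M (U - F) < \<delta> i"
        using Union.IH \<delta>_pos by metis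
      then obtain F U where F: "\<And>i. closed (F i)" and U: "\<And>i. open (U i)"
        and sub: "\<And>i. F i \<subseteq> A i" "\<And>i. A i \<subseteq> U i" and small: "\<And>i. measure M (U i - F i) < \<delta> i"
        by metis
      have \<delta>_sums: "\<delta> sums (e / 2)"
        unfolding \<delta>_def using sums_mult[OF geometric_sums[of "1/2 :: real"], of "e / 4"] by simp
      have summ: "summable (\<lambda>i. measure M (U i - F i))"
        using small by (intro summable_comparison_test'[OF sums_summable[OF \<delta>_sums], of 0])
          (auto simp: less_imp_le)
      have "measure M (\<Union>i. U i - F i) \<le> (\<Sum>i. measure M (U i - F i))"
        using meas F U by (intro finite_measure_subadditive_countably summ) (auto intro!: sets.Diff)
      also have "\<dots> \<le> (\<Sum>i. \<delta> i)"
        using small by (intro suminf_le summ sums_summable[OF \<delta>_sums]) (auto simp: less_imp_le)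
      also have "\<dots> = e / 2" using \<delta>_sums by (simp add: sums_iff)
      finally have head: "measure M (\<Union>i. U i - F i) \<le> e / 2" .
      define G where "G n = (\<Union>i\<le>n. F i)" for n
      have clG: "closed (G n)" for n unfolding G_def using F by auto
      have UG: "(\<Union>n. G n) = (\<Union>i. F i)" unfolding G_def by auto
      have mUF: "(\<Union>i. F i) \<in> sets M" using meas F by (intro sets.countable_UN) auto
      have "incseq G" unfolding G_def incseq_def by (auto intro: order_trans)
      then have "(\<lambda>n. measure M (G n)) \<longlonglongrightarrow> measure M (\<Union>i. F i)"
        using finite_Lim_measure_incseq[of G] meas clG UG by (auto simp: image_subset_iff)
      then have "\<forall>\<^sub>F n in sequentially. measure M (\<Union>i. F i) - e / 2 < measure M (G n)"
        using e by (intro order_tendstoD) auto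
      then obtain n where n: "measure M (\<Union>i. F i) - e / 2 < measure M (G n)"
        using eventually_sequentially by auto
      have "G n \<subseteq> (\<Union>i. F i)" unfolding G_def by auto
      then have tail: "measure M ((\<Union>i. F i) - G n) < e / 2"
        using n finite_measure_Diff[of "\<Union>i. F i" "G n"] mUF meas clG by auto
      have "measure M ((\<Union>i. U i) - G n) \<le> measure M ((\<Union>i. U i - F i) \<union> ((\<Union>i. F i) - G n))"
        using meas F U clG mUF by (intro finite_measure_mono sets.Un sets.countable_UN sets.Diff) auto
      also have "\<dots> \<le> measure M (\<Union>i. U i - F i) + measure M ((\<Union>i. F i) - G n)"
        using meas F U clG mUF by (intro measure_Un_le sets.countable_UN sets.Diff) (auto intro!: sets.Diff)
      also have "\<dots> < e" using head tail by linarith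
      finally have "measure M ((\<Union>i. U i) - G n) < e" .
      moreover have "G n \<subseteq> (\<Union>i. A i)" "(\<Union>i. A i) \<subseteq> (\<Union>i. U i)"
        unfolding G_def using sub by blast+
      moreover have "open (\<Union>i. U i)" using U by auto
      ultimately have "closed (G n) \<and> open (\<Union>i. U i) \<and> G n \<subseteq> (\<Union>i. A i) \<and> (\<Union>i. A i) \<subseteq> (\<Union>i. U i)
          \<and> measure M ((\<Union>i. U i) - G n) < e"
        using clG[of n] by simp
      then show "\<exists>F U'. closed F \<and> open U' \<and> F \<subseteq> (\<Union>i. A i) \<and> (\<Union>i. A i) \<subseteq> U' \<and> measure M (U' - F) < e"
        by (intro exI)
    qed
  qed
qed

text \<open>
  Since \<open>X\<close> is closed, \<open>\<mu>\<close> extends by zero to all Borel sets, and closed subsets of \<open>X\<close> are compact.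
\<close>

lemma compact_inner_approximation:
  fixes X :: "'a::metric_space set"
  assumes fm: "finite_measure \<mu>" and sets: "sets \<mu> = sets (restrict_space borel X)"
    and X: "compact X" and A: "A \<in> sets \<mu>" and e: "e > 0"
  shows "\<exists>K. compact K \<and> K \<subseteq> A \<and> measure \<mu> (A - K) < e"
proof -
  interpret finite_measure \<mu> by fact
  have space: "space \<mu> = X"
    using sets_eq_imp_space_eq[OF sets] by (simp add: space_restrict_space)
  have sets': "sets \<mu> = {B \<in> sets borel. B \<subseteq> X}"
    unfolding sets using compact_imp_closed[OF X] by (auto simp: sets_restrict_space_iff)
  let ?N = "distr \<mu> borel (\<lambda>x. x)"
  have id: "(\<lambda>x. x) \<in> measurable \<mu> borel"
    using measurable_restrict_space1[of "\<lambda>x. x" borel borel X] measurable_cong_sets[OF sets refl] by auto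
  have "finite_measure ?N" by (rule finite_measure_distr[OF id])
  then obtain F U where F: "closed F" "open U" "F \<subseteq> A" "A \<subseteq> U" "measure ?N (U - F) < e"
    using borel_squeeze_closed_open[of ?N A] A e sets' by auto
  have "U - F \<in> sets borel" using F by auto
  then have "measure ?N (U - F) = measure \<mu> ((U - F) \<inter> X)"
    by (simp add: measure_distr[OF id] space)
  moreover have "measure \<mu> (A - F) \<le> measure \<mu> ((U - F) \<inter> X)"
    using A F compact_imp_closed[OF X] by (intro finite_measure_mono) (auto simp: sets')
  ultimately have "measure \<mu> (A - F) < e" using F by simp
  moreover have "compact F"
  proof -
    have "F = X \<inter> F" using F A sets' by auto
    then show ?thesis using X F by (metis compact_Int_closed)
  qed
  ultimately show ?thesis using F by blast
qed

section \<open>Words, suffixes and itineraries\<close>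

lemma word_map_append: "word_map f (u @ v) = word_map f u \<circ> word_map f v"
  by (induction u) auto

lemma strict_suffixes_Nil [simp]: "{w'. strict_suffix w' []} = {}"
  by (auto simp: strict_suffix_def)

lemma strict_suffixes_Cons: "{w'. strict_suffix w' (i # w)} = insert w {w'. strict_suffix w' w}"
  by (auto simp: strict_suffix_def suffix_Cons dest: suffix_length_le)

lemma finite_strict_suffixes [simp]: "finite {w'. strict_suffix w' w}"
  by (induction w) (simp_all add: strict_suffixes_Cons)

lemma strict_suffix_append: "strict_suffix v' v \<Longrightarrow> strict_suffix v' (u @ v)"
  by (auto simp: strict_suffix_def suffix_def)

lemma word_sum_Nil [simp]: "word_sum f [] \<phi> x = 0"
  by (simp add: word_sum_def)

lemma word_sum_Cons: "word_sum f (i # w) \<phi> x = \<phi> (word_map f w x) + word_sum f w \<phi> x"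
  unfolding word_sum_def strict_suffixes_Cons by simp

lemma word_dist_lessD:
  assumes "word_dist f w x y < \<epsilon>" "strict_suffix w' w"
  shows "dist (word_map f w' x) (word_map f w' y) < \<epsilon>"
  by (rule le_less_trans[OF _ assms(1)]) (use assms(2) in \<open>auto simp: word_dist_def\<close>)

text \<open>
  The join of the partitions \<open>f\<^bsub>w'\<^esub>\<inverse> \<xi>\<close> over the proper suffixes \<open>w'\<close> of \<open>w\<close> separates two points iff one of
  these suffixes takes them to different cells of \<open>\<xi>\<close>. So the atoms of the join are the sets of constancy
  of the list of cells visited. With lists, concatenation of words becomes concatenation of itineraries.
\<close>

definition cell :: "'a set set \<Rightarrow> 'a \<Rightarrow> 'a set" where
  "cell \<xi> x = (THE A. A \<in> \<xi> \<and> x \<in> A)"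

primrec itinerary :: "(nat \<Rightarrow> 'a \<Rightarrow> 'a) \<Rightarrow> 'a set set \<Rightarrow> nat list \<Rightarrow> 'a \<Rightarrow> 'a set list" where
  "itinerary f \<xi> [] x = []"
| "itinerary f \<xi> (i # w) x = cell \<xi> (word_map f w x) # itinerary f \<xi> w x"

lemma length_itinerary [simp]: "length (itinerary f \<xi> w x) = length w"
  by (induction w) auto

text \<open>
  The letters of \<open>u @ v\<close> act from the right: the suffixes of \<open>u @ v\<close> are first those of \<open>v\<close> and then \<open>u' @ v\<close>
  for suffixes \<open>u'\<close> of \<open>u\<close>.
\<close>

lemma itinerary_append:
  "itinerary f \<xi> (u @ v) x = itinerary f \<xi> u (word_map f v x) @ itinerary f \<xi> v x"
  by (induction u) (auto simp: word_map_append)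

lemma itinerary_eq_iff:
  "itinerary f \<xi> w x = itinerary f \<xi> w y \<longleftrightarrow>
     (\<forall>w'. strict_suffix w' w \<longrightarrow> cell \<xi> (word_map f w' x) = cell \<xi> (word_map f w' y))"
proof (induction w)
  case Nil
  then show ?case by (simp add: strict_suffix_def)
next
  case (Cons i w)
  have "strict_suffix w' (i # w) \<longleftrightarrow> w' = w \<or> strict_suffix w' w" for w'
    using strict_suffixes_Cons[of i w] by blast
  then show ?case using Cons by auto
qed

section \<open>Systems with an invariant measure\<close>

locale invariant_system =
  fixes X :: "'a::metric_space set" and m :: nat and f :: "nat \<Rightarrow> 'a \<Rightarrow> 'a" and \<mu> :: "'a measure"
  assumes m_pos: "m \<ge> 1" and compact: "compact X"
    and maps: "\<And>i. i < m \<Longrightarrow> f i \<in> X \<rightarrow> X"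
    and cont: "\<And>i. i < m \<Longrightarrow> continuous_on X (f i)"
    and invariant: "\<mu> \<in> invariant_measures X m f"
begin

sublocale prob_space \<mu>
  using invariant by (simp add: invariant_measures_def)

lemma sets_eq: "sets \<mu> = sets (restrict_space borel X)"
  using invariant by (simp add: invariant_measures_def)

lemma space_eq [simp]: "space \<mu> = X"
  using sets_eq_imp_space_eq[OF sets_eq] by (simp add: space_restrict_space)

lemma word_map_in: "set w \<subseteq> {..<m} \<Longrightarrow> x \<in> X \<Longrightarrow> word_map f w x \<in> X"
  using maps by (induction w) auto

lemma continuous_word_map: "set w \<subseteq> {..<m} \<Longrightarrow> continuous_on X (word_map f w)"
proof (induction w)
  case (Cons i w)
  have "continuous_on (word_map f w ` X) (f i)"
    by (rule continuous_on_subset[OF cont]) (use Cons.prems word_map_in[of w] in auto)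
  then show ?case using Cons continuous_on_compose[of X "word_map f w" "f i"] by simp
qed (simp add: id_def)

lemma measurable_continuous:
  assumes "continuous_on X (g :: 'a \<Rightarrow> 'b::topological_space)"
  shows "g \<in> borel_measurable \<mu>"
  using borel_measurable_continuous_on_restrict[OF assms] measurable_cong_sets[OF sets_eq refl] by auto

lemma measurable_word_map:
  assumes "set w \<subseteq> {..<m}"
  shows "word_map f w \<in> measurable \<mu> \<mu>"
proof -
  have "word_map f w \<in> measurable \<mu> (restrict_space borel X)"
    using measurable_continuous[OF continuous_word_map[OF assms]] word_map_in[OF assms]
    by (intro measurable_restrict_space2) auto
  then show ?thesis using measurable_cong_sets[OF refl sets_eq] by auto
qed

text \<open>
  Invariance under the generators carries over to all words. This is what makes the statistics of a
  block of letters independent of its position in a longer word.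
\<close>

lemma measure_word_map_vimage:
  assumes "set w \<subseteq> {..<m}" "A \<in> sets \<mu>"
  shows "measure \<mu> (word_map f w -` A \<inter> X) = measure \<mu> A"
  using assms
proof (induction w arbitrary: A)
  case Nil
  have "A \<inter> X = A" using sets.sets_into_space[OF Nil(2)] by auto
  then show ?case by simp
next
  case (Cons i w)
  have i: "f i \<in> measurable \<mu> \<mu>" using measurable_word_map[of "[i]"] Cons.prems by (simp add: comp_def)
  have fi: "f i -` A \<inter> X \<in> sets \<mu>" using measurable_sets[OF i Cons.prems(2)] by simp
  have "word_map f (i # w) -` A \<inter> X = word_map f w -` (f i -` A \<inter> X) \<inter> X"
    using word_map_in[of w] Cons.prems by auto
  then have "measure \<mu> (word_map f (i # w) -` A \<inter> X) = measure \<mu> (f i -` A \<inter> X)"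
    using Cons.IH[OF _ fi] Cons.prems by simp
  also have "\<dots> = measure \<mu> A"
    using invariant Cons.prems by (simp add: invariant_measures_def)
  finally show ?case .
qed

lemma distr_word_map:
  assumes "set w \<subseteq> {..<m}"
  shows "distr \<mu> \<mu> (word_map f w) = \<mu>"
proof (rule measure_eqI)
  fix A assume "A \<in> sets (distr \<mu> \<mu> (word_map f w))"
  then show "emeasure (distr \<mu> \<mu> (word_map f w)) A = emeasure \<mu> A"
    using measurable_word_map[OF assms] measure_word_map_vimage[OF assms, of A]
    by (simp add: emeasure_distr emeasure_eq_measure)
qed simp

lemma integrable_continuous:
  assumes "continuous_on X (g :: 'a \<Rightarrow> real)"
  shows "integrable \<mu> g"
proof -
  have "bounded (g ` X)"
    using compact_imp_bounded[OF compact_continuous_image[OF assms compact]] .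
  then obtain B where "\<And>x. x \<in> X \<Longrightarrow> norm (g x) \<le> B" by (auto simp: bounded_iff)
  then show ?thesis
    using measurable_continuous[OF assms] by (intro integrable_const_bound[of _ B]) auto
qed

lemma integral_word_map:
  assumes "set w \<subseteq> {..<m}" "g \<in> borel_measurable \<mu>"
  shows "(\<integral>x. g (word_map f w x) \<partial>\<mu>) = (\<integral>x. (g x :: real) \<partial>\<mu>)"
  using integral_distr[OF measurable_word_map[OF assms(1)] assms(2)] distr_word_map[OF assms(1)] by simp

lemma integrable_word_map:
  assumes "set w \<subseteq> {..<m}" "integrable \<mu> (g :: 'a \<Rightarrow> real)"
  shows "integrable \<mu> (\<lambda>x. g (word_map f w x))"
  using integrable_distr[OF measurable_word_map[OF assms(1)], of g] distr_word_map[OF assms(1)] assms(2)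
  by simp

lemma integral_word_sum:
  assumes "set w \<subseteq> {..<m}" "continuous_on X \<phi>"
  shows "integrable \<mu> (word_sum f w \<phi>)" "(\<integral>x. word_sum f w \<phi> x \<partial>\<mu>) = length w * (\<integral>x. \<phi> x \<partial>\<mu>)"
proof -
  note int = integrable_continuous[OF assms(2)]
  have "integrable \<mu> (word_sum f w \<phi>) \<and> (\<integral>x. word_sum f w \<phi> x \<partial>\<mu>) = length w * (\<integral>x. \<phi> x \<partial>\<mu>)"
    using assms(1)
  proof (induction w)
    case Nil
    then show ?case by (simp add: word_sum_Nil[abs_def] del: word_sum_Nil)
  next
    case (Cons i w)
    have *: "word_sum f (i # w) \<phi> = (\<lambda>x. \<phi> (word_map f w x) + word_sum f w \<phi> x)"
      by (simp add: word_sum_Cons fun_eq_iff)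
    show ?case
      unfolding * using Cons integrable_word_map[of w \<phi>] integral_word_map[of w \<phi>] int
      by (simp add: algebra_simps)
  qed
  then show "integrable \<mu> (word_sum f w \<phi>)" "(\<integral>x. word_sum f w \<phi> x \<partial>\<mu>) = length w * (\<integral>x. \<phi> x \<partial>\<mu>)"
    by auto
qed

end

section \<open>Entropy of a partition along words\<close>

locale partitioned_system = invariant_system +
  fixes \<xi> :: "'a set set"
  assumes partition: "\<xi> \<in> finite_partitions \<mu>"
begin

lemma finite_partition: "finite \<xi>" and partition_sets: "A \<in> \<xi> \<Longrightarrow> A \<in> sets \<mu>"
  and partition_on: "partition_on X \<xi>"
  using partition by (auto simp: finite_partitions_def)

lemma cell_unique: "A \<in> \<xi> \<Longrightarrow> x \<in> A \<Longrightarrow> cell \<xi> x = A"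
  unfolding cell_def using partition_onD2[OF partition_on]
  by (intro the_equality) (auto simp: disjoint_def)

lemma cell_in:
  assumes "x \<in> X" shows "cell \<xi> x \<in> \<xi>" "x \<in> cell \<xi> x"
proof -
  obtain A where "A \<in> \<xi>" "x \<in> A" using assms partition_onD1[OF partition_on] by auto
  with cell_unique[OF this] show "cell \<xi> x \<in> \<xi>" "x \<in> cell \<xi> x" by auto
qed

lemma cell_eq_iff: "x \<in> X \<Longrightarrow> A \<in> \<xi> \<Longrightarrow> cell \<xi> x = A \<longleftrightarrow> x \<in> A"
  using cell_unique cell_in by blast

definition labels :: "nat \<Rightarrow> 'a set list set" where
  "labels n = {s. set s \<subseteq> \<xi> \<and> length s = n}"

definition cylinder :: "nat list \<Rightarrow> 'a set list \<Rightarrow> 'a set" where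
  "cylinder w s = {x \<in> X. itinerary f \<xi> w x = s}"

text \<open>
  The sum runs over all lists of cells of the right length; those that are no itinerary have an empty
  cylinder and contribute \<open>0\<close>. So all words of one length share one finite index set.
\<close>

definition entropy_along :: "nat list \<Rightarrow> real" where
  "entropy_along w =
     - (\<Sum>s\<in>labels (length w). prob (cylinder w s) * ln (prob (cylinder w s)))"

lemma finite_labels [simp]: "finite (labels n)"
  unfolding labels_def using finite_partition by (rule finite_lists_length_eq)

lemma itinerary_in_labels:
  "set w \<subseteq> {..<m} \<Longrightarrow> x \<in> X \<Longrightarrow> itinerary f \<xi> w x \<in> labels (length w)"
proof (induction w)
  case (Cons i w)
  then show ?case using word_map_in[of w x] cell_in by (auto simp: labels_def)
qed (simp add: labels_def)

lemma labels_nonempty: "labels n \<noteq> {}"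
proof -
  obtain x where "x \<in> X" using not_empty by auto
  then have "replicate n (cell \<xi> x) \<in> labels n" using cell_in by (auto simp: labels_def)
  then show ?thesis by auto
qed

lemma sum_labels_append:
  fixes F :: "'a set list \<Rightarrow> 'c::comm_monoid_add"
  shows "(\<Sum>s\<in>labels (k + n). F s) = (\<Sum>a\<in>labels k. \<Sum>b\<in>labels n. F (a @ b))"
  unfolding labels_def by (rule sum_lists_append)

lemma cylinder_append:
  assumes "length b = length v" "set v \<subseteq> {..<m}"
  shows "cylinder (u @ v) (a @ b) = (word_map f v -` cylinder u a \<inter> X) \<inter> cylinder v b"
  using assms word_map_in by (auto simp: cylinder_def itinerary_append)

lemma cylinder_sets:
  assumes "set w \<subseteq> {..<m}" "s \<in> labels (length w)"
  shows "cylinder w s \<in> sets \<mu>"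
  using assms
proof (induction w arbitrary: s)
  case Nil
  then have "cylinder [] s = space \<mu>" by (auto simp: cylinder_def labels_def)
  then show ?case by (simp only: sets.top)
next
  case (Cons i w)
  then obtain A s' where s: "s = A # s'" "A \<in> \<xi>" "s' \<in> labels (length w)"
    by (auto simp: labels_def length_Suc_conv)
  have "cylinder (i # w) s = (word_map f w -` A \<inter> space \<mu>) \<inter> cylinder w s'"
    using word_map_in[of w] Cons.prems s cell_eq_iff by (auto simp: cylinder_def)
  then show ?case
    using Cons.IH[OF _ s(3)] Cons.prems measurable_sets[OF measurable_word_map partition_sets[OF s(2)], of w]
    by auto
qed

text \<open>
  Both sides are the expectation of \<open>g\<close> of the random itinerary. Through the right-hand side, invariance
  and pointwise estimates become available for sums over cylinders.
\<close>

lemma sum_cylinder_eq_integral: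
  fixes g :: "'a set list \<Rightarrow> real"
  assumes w: "set w \<subseteq> {..<m}"
  shows "integrable \<mu> (\<lambda>x. g (itinerary f \<xi> w x))"
    and "(\<Sum>s\<in>labels (length w). prob (cylinder w s) * g s) = (\<integral>x. g (itinerary f \<xi> w x) \<partial>\<mu>)"
proof -
  let ?g = "\<lambda>x. \<Sum>s\<in>labels (length w). indicator (cylinder w s) x * g s"
  have g: "?g x = g (itinerary f \<xi> w x)" if "x \<in> space \<mu>" for x
  proof -
    have "?g x = (\<Sum>s\<in>labels (length w). if s = itinerary f \<xi> w x then g s else 0)"
      using that by (intro sum.cong) (auto simp: cylinder_def)
    then show ?thesis using itinerary_in_labels[OF w] that by simp
  qed
  have int: "integrable \<mu> (\<lambda>x. indicator (cylinder w s) x * g s)" if "s \<in> labels (length w)" for s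
    using cylinder_sets[OF w that] by (intro integrable_mult_left integrable_real_indicator) (auto simp: less_top[symmetric])
  then have "integrable \<mu> ?g" by (rule Bochner_Integration.integrable_sum)
  then show "integrable \<mu> (\<lambda>x. g (itinerary f \<xi> w x))"
    using g by (subst Bochner_Integration.integrable_cong[OF refl, of _ _ ?g]) auto
  have "(\<integral>x. g (itinerary f \<xi> w x) \<partial>\<mu>) = (\<integral>x. ?g x \<partial>\<mu>)"
    using g by (intro Bochner_Integration.integral_cong) auto
  also have "\<dots> = (\<Sum>s\<in>labels (length w). \<integral>x. indicator (cylinder w s) x * g s \<partial>\<mu>)"
    by (rule Bochner_Integration.integral_sum[OF int])
  also have "\<dots> = (\<Sum>s\<in>labels (length w). prob (cylinder w s) * g s)"
  proof (intro sum.cong refl)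
    fix s
    have "cylinder w s \<inter> X = cylinder w s" by (auto simp: cylinder_def)
    then show "(\<integral>x. indicator (cylinder w s) x * g s \<partial>\<mu>) = prob (cylinder w s) * g s" by simp
  qed
  finally show "(\<Sum>s\<in>labels (length w). prob (cylinder w s) * g s) = (\<integral>x. g (itinerary f \<xi> w x) \<partial>\<mu>)" ..
qed

lemma sum_prob_cylinder:
  assumes "set w \<subseteq> {..<m}"
  shows "(\<Sum>s\<in>labels (length w). prob (cylinder w s)) = 1"
  using sum_cylinder_eq_integral(2)[OF assms, of "\<lambda>_. 1"] prob_space by simp

lemma entropy_along_nonneg: "entropy_along w \<ge> 0"
proof -
  have "prob A * ln (prob A) \<le> 0" for A
    by (cases "prob A = 0") (auto intro!: mult_nonneg_nonpos simp: zero_less_measure_iff)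
  then show ?thesis unfolding entropy_along_def by (simp add: sum_nonpos)
qed

text \<open>
  Apply Gibbs' inequality with the product of the two marginals as weights. By invariance of \<open>\<mu>\<close> under
  \<open>f\<^bsub>v\<^esub>\<close>, the first block of the itinerary along \<open>u @ v\<close>, which starts at \<open>f\<^bsub>v\<^esub> x\<close>, has the distribution of
  itineraries along \<open>u\<close>.
\<close>

lemma entropy_along_append:
  assumes u: "set u \<subseteq> {..<m}" and v: "set v \<subseteq> {..<m}"
  shows "entropy_along (u @ v) \<le> entropy_along u + entropy_along v"
proof -
  let ?p = "\<lambda>w s. prob (cylinder w s)"
  let ?I = "labels (length u) \<times> labels (length v)"
  have uv: "set (u @ v) \<subseteq> {..<m}" using u v by simp
  have split: "(\<Sum>s\<in>labels (length (u @ v)). F s) = (\<Sum>(a, b)\<in>?I. F (a @ b))" for F :: "_ \<Rightarrow> real"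
    by (simp add: sum_labels_append sum.cartesian_product)
  have le_u: "?p (u @ v) (a @ b) \<le> ?p u a" if "(a, b) \<in> ?I" for a b
  proof -
    have a: "cylinder u a \<in> sets \<mu>" using cylinder_sets[OF u] that by auto
    have "?p (u @ v) (a @ b) \<le> prob (word_map f v -` cylinder u a \<inter> X)"
      using that measurable_sets[OF measurable_word_map[OF v] a]
      by (subst cylinder_append[OF _ v]) (auto simp: labels_def intro!: finite_measure_mono)
    also have "\<dots> = ?p u a" by (rule measure_word_map_vimage[OF v a])
    finally show ?thesis .
  qed
  have le_v: "?p (u @ v) (a @ b) \<le> ?p v b" if "(a, b) \<in> ?I" for a b
    using that cylinder_sets[OF v, of b]
    by (subst cylinder_append[OF _ v]) (auto simp: labels_def intro!: finite_measure_mono)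
  have "entropy_along (u @ v) = - (\<Sum>(a, b)\<in>?I. ?p (u @ v) (a @ b) * ln (?p (u @ v) (a @ b)))"
    unfolding entropy_along_def by (subst split) simp
  also have "\<dots> \<le> ln 1 - (\<Sum>(a, b)\<in>?I. ?p (u @ v) (a @ b) * ln (?p u a * ?p v b))"
    unfolding case_prod_unfold
  proof (rule gibbs_inequality)
    show "(\<Sum>i\<in>?I. ?p (u @ v) (fst i @ snd i)) = 1"
      using split[of "?p (u @ v)"] sum_prob_cylinder[OF uv] by (simp add: case_prod_unfold)
    have "(\<Sum>i\<in>?I. ?p u (fst i) * ?p v (snd i)) = 1"
      using sum_prob_cylinder[OF u] sum_prob_cylinder[OF v] sum.cartesian_product[of "\<lambda>a b. ?p u a * ?p v b" "labels (length v)" "labels (length u)"]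
      by (simp add: case_prod_unfold flip: sum_distrib_left sum_distrib_right)
    then show "(\<Sum>i\<in>?I. ?p u (fst i) * ?p v (snd i)) \<le> 1" by simp
    fix i assume "i \<in> ?I"
    moreover assume "?p u (fst i) * ?p v (snd i) = 0"
    ultimately show "?p (u @ v) (fst i @ snd i) = 0"
      using le_u[of "fst i" "snd i"] le_v[of "fst i" "snd i"] measure_nonneg[of \<mu>]
      by (metis antisym mult_eq_0_iff prod.collapse)
  qed auto
  also have "\<dots> = - (\<Sum>(a, b)\<in>?I. ?p (u @ v) (a @ b) * ln (?p u a)) - (\<Sum>(a, b)\<in>?I. ?p (u @ v) (a @ b) * ln (?p v b))"
  proof -
    have "?p (u @ v) (a @ b) * ln (?p u a * ?p v b) =
        ?p (u @ v) (a @ b) * ln (?p u a) + ?p (u @ v) (a @ b) * ln (?p v b)" if "(a, b) \<in> ?I" for a b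
    proof (cases "?p (u @ v) (a @ b) = 0")
      case False
      then have "?p u a > 0" "?p v b > 0"
        using le_u[OF that] le_v[OF that] measure_nonneg[of \<mu>] by (metis antisym_conv less_eq_real_def)+
      then show ?thesis by (simp add: ln_mult algebra_simps)
    qed simp
    then have "(\<Sum>(a, b)\<in>?I. ?p (u @ v) (a @ b) * ln (?p u a * ?p v b)) =
       (\<Sum>(a, b)\<in>?I. ?p (u @ v) (a @ b) * ln (?p u a) + ?p (u @ v) (a @ b) * ln (?p v b))"
      by (intro sum.cong) auto
    then show ?thesis by (simp add: sum.distrib case_prod_unfold)
  qed
  also have "(\<Sum>(a, b)\<in>?I. ?p (u @ v) (a @ b) * ln (?p u a)) = (\<Sum>a\<in>labels (length u). ?p u a * ln (?p u a))"
  proof -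
    have "(\<Sum>(a, b)\<in>?I. ?p (u @ v) (a @ b) * ln (?p u a)) =
        (\<Sum>(a, b)\<in>?I. ?p (u @ v) (a @ b) * ln (?p u (take (length u) (a @ b))))"
      by (intro sum.cong) (auto simp: labels_def)
    also have "\<dots> = (\<integral>x. ln (?p u (take (length u) (itinerary f \<xi> (u @ v) x))) \<partial>\<mu>)"
      by (subst split[symmetric], subst sum_cylinder_eq_integral(2)[OF uv]) simp
    also have "\<dots> = (\<integral>x. ln (?p u (itinerary f \<xi> u (word_map f v x))) \<partial>\<mu>)"
      by (simp add: itinerary_append)
    also have "\<dots> = (\<integral>x. ln (?p u (itinerary f \<xi> u x)) \<partial>\<mu>)"
      by (rule integral_word_map[OF v borel_measurable_integrable[OF sum_cylinder_eq_integral(1)[OF u]]])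
    also have "\<dots> = (\<Sum>a\<in>labels (length u). ?p u a * ln (?p u a))"
      by (rule sum_cylinder_eq_integral(2)[OF u, symmetric])
    finally show ?thesis .
  qed
  also have "(\<Sum>(a, b)\<in>?I. ?p (u @ v) (a @ b) * ln (?p v b)) = (\<Sum>b\<in>labels (length v). ?p v b * ln (?p v b))"
  proof -
    have "(\<Sum>(a, b)\<in>?I. ?p (u @ v) (a @ b) * ln (?p v b)) =
        (\<Sum>(a, b)\<in>?I. ?p (u @ v) (a @ b) * ln (?p v (drop (length u) (a @ b))))"
      by (intro sum.cong) (auto simp: labels_def)
    also have "\<dots> = (\<integral>x. ln (?p v (drop (length u) (itinerary f \<xi> (u @ v) x))) \<partial>\<mu>)"
      by (subst split[symmetric], subst sum_cylinder_eq_integral(2)[OF uv]) simp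
    also have "\<dots> = (\<integral>x. ln (?p v (itinerary f \<xi> v x)) \<partial>\<mu>)"
      by (simp add: itinerary_append)
    also have "\<dots> = (\<Sum>b\<in>labels (length v). ?p v b * ln (?p v b))"
      by (rule sum_cylinder_eq_integral(2)[OF v, symmetric])
    finally show ?thesis .
  qed
  finally show ?thesis by (simp add: entropy_along_def)
qed

text \<open>
  An element of the join that contains \<open>x\<close> must choose from each preimage partition the cell containing
  \<open>x\<close>, and so is the cylinder of \<open>x\<close>. The empty word is excluded: its join is over no partitions at all.
\<close>

lemma word_join_eq_cylinders:
  assumes w: "set w \<subseteq> {..<m}" and ne: "w \<noteq> []"
  shows "word_join X f \<xi> w = cylinder w ` labels (length w) - {{}}"
proof -
  let ?S = "{w'. strict_suffix w' w}"
  let ?P = "\<lambda>w'. preimage_partition X (word_map f w') \<xi>"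
  have Sne: "?S \<noteq> {}" using ne by (auto intro!: exI[of _ "tl w"])
  have suf: "word_map f w' x \<in> X" if "w' \<in> ?S" "x \<in> X" for w' x
    using that word_map_in strict_suffix_set_subset[of w' w] w by fastforce
  define D where "D x = (\<Inter>w'\<in>?S. word_map f w' -` cell \<xi> (word_map f w' x) \<inter> X)" for x
  have D: "D x = cylinder w (itinerary f \<xi> w x)" if "x \<in> X" for x
  proof -
    have "y \<in> D x \<longleftrightarrow> y \<in> cylinder w (itinerary f \<xi> w x)" for y
    proof -
      have "y \<in> D x \<longleftrightarrow> y \<in> X \<and> (\<forall>w'\<in>?S. word_map f w' y \<in> cell \<xi> (word_map f w' x))"
        unfolding D_def using Sne by auto
      also have "\<dots> \<longleftrightarrow> y \<in> X \<and> (\<forall>w'\<in>?S. cell \<xi> (word_map f w' y) = cell \<xi> (word_map f w' x))"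
        using suf that cell_in cell_eq_iff by (metis (no_types, lifting))
      also have "\<dots> \<longleftrightarrow> y \<in> cylinder w (itinerary f \<xi> w x)"
        by (auto simp: cylinder_def itinerary_eq_iff)
      finally show ?thesis .
    qed
    then show ?thesis by blast
  qed
  have "word_join X f \<xi> w = D ` X"
  proof (intro equalityI subsetI)
    fix B assume "B \<in> word_join X f \<xi> w"
    then obtain g where g: "\<And>w'. w' \<in> ?S \<Longrightarrow> g (?P w') \<in> ?P w'" and B: "B = (\<Inter>w'\<in>?S. g (?P w'))"
      and "B \<noteq> {}"
      unfolding word_join_def common_refinement by (auto simp: image_image)
    then obtain x where x: "x \<in> B" by auto
    have *: "g (?P w') = word_map f w' -` cell \<xi> (word_map f w' x) \<inter> X \<and> x \<in> X" if "w' \<in> ?S" for w'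
    proof -
      from g[OF that] obtain A where A: "A \<in> \<xi>" "g (?P w') = word_map f w' -` A \<inter> X"
        by (auto simp: preimage_partition_def)
      with x that have "word_map f w' x \<in> A" "x \<in> X" unfolding B by auto
      with A cell_unique show ?thesis by metis
    qed
    then have "B = D x" unfolding B D_def by auto
    moreover have "x \<in> X" using * Sne by auto
    ultimately show "B \<in> D ` X" by auto
  next
    fix B assume "B \<in> D ` X"
    then obtain x where x: "x \<in> X" "B = D x" by auto
    define g where "g Q = (THE C. C \<in> Q \<and> x \<in> C)" for Q :: "'a set set"
    have g: "g (?P w') = word_map f w' -` cell \<xi> (word_map f w' x) \<inter> X" if "w' \<in> ?S" for w'
      unfolding g_def
    proof (rule the_equality)
      show "word_map f w' -` cell \<xi> (word_map f w' x) \<inter> X \<in> ?P w' \<and> x \<in> word_map f w' -` cell \<xi> (word_map f w' x) \<inter> X"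
        using cell_in[OF suf[OF that x(1)]] x by (auto simp: preimage_partition_def)
    next
      fix C assume "C \<in> ?P w' \<and> x \<in> C"
      then show "C = word_map f w' -` cell \<xi> (word_map f w' x) \<inter> X"
        using cell_unique by (auto simp: preimage_partition_def)
    qed
    have "g \<in> (\<Pi> Q\<in>?P ` ?S. Q)"
      using g cell_in suf x by (auto simp: preimage_partition_def)
    moreover have "B = \<Inter> (g ` (?P ` ?S))"
      using g unfolding x D_def by (auto simp: image_image)
    moreover have "B \<noteq> {}" using x D[OF x(1)] by (auto simp: cylinder_def)
    ultimately show "B \<in> word_join X f \<xi> w"
      unfolding word_join_def common_refinement by blast
  qed
  also have "\<dots> = cylinder w ` labels (length w) - {{}}"
    using D itinerary_in_labels[OF w] by (auto simp: image_iff) (auto simp: cylinder_def)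
  finally show ?thesis .
qed

lemma partition_entropy_word_join:
  assumes w: "set w \<subseteq> {..<m}" and ne: "w \<noteq> []"
  shows "partition_entropy \<mu> (word_join X f \<xi> w) = entropy_along w"
proof -
  let ?h = "\<lambda>A. prob A * ln (prob A)"
  have "(\<Sum>A\<in>word_join X f \<xi> w. ?h A) = (\<Sum>A\<in>cylinder w ` labels (length w). ?h A)"
    unfolding word_join_eq_cylinders[OF assms] by (rule sum.mono_neutral_left) auto
  also have "\<dots> = (\<Sum>s\<in>labels (length w). ?h (cylinder w s))"
  proof (rule sum.reindex_nontrivial[unfolded comp_def])
    fix s t assume "s \<noteq> t" "cylinder w s = cylinder w t"
    then have "cylinder w s = {}" by (auto simp: cylinder_def)
    then show "?h (cylinder w s) = 0" by simp
  qed simp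
  finally show ?thesis by (simp add: partition_entropy_def entropy_along_def)
qed

definition mean_entropy :: "nat \<Rightarrow> real" where
  "mean_entropy n = (\<Sum>w\<in>words m n. entropy_along w) / m ^ n"

lemma mean_entropy_add: "mean_entropy (k + n) \<le> mean_entropy k + mean_entropy n"
proof -
  have "(\<Sum>w\<in>words m (k + n). entropy_along w) \<le>
      (\<Sum>u\<in>words m k. \<Sum>v\<in>words m n. entropy_along u + entropy_along v)"
    unfolding sum_words_append
    by (intro sum_mono entropy_along_append) (auto simp: words_def)
  also have "\<dots> = m ^ n * (\<Sum>u\<in>words m k. entropy_along u) + m ^ k * (\<Sum>v\<in>words m n. entropy_along v)"
    by (simp add: sum.distrib card_words sum_distrib_left)
  finally show ?thesis
    using m_pos by (simp add: mean_entropy_def field_simps power_add)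
qed

text \<open>
  \<^const>\<open>measure_entropy_wrt\<close> is defined by \<^const>\<open>lim\<close>, which says nothing about the sequence before its
  convergence is known; subadditivity provides it.
\<close>

lemma mean_entropy_tendsto:
  "(\<lambda>n. mean_entropy n / n) \<longlonglongrightarrow> measure_entropy_wrt \<mu> m f \<xi>"
proof -
  have "mean_entropy n \<ge> 0" for n
    unfolding mean_entropy_def using entropy_along_nonneg by (auto intro!: divide_nonneg_nonneg sum_nonneg)
  then have conv: "convergent (\<lambda>n. mean_entropy n / n)"
    using mean_entropy_add by (intro subadditive_nonneg_convergent)
  have "1 / real n * (1 / real (m ^ n) * (\<Sum>w\<in>words m n. partition_entropy \<mu> (word_join (space \<mu>) f \<xi> w)))
      = mean_entropy n / n" for n
  proof (cases "n = 0")
    case False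
    then have "(\<Sum>w\<in>words m n. partition_entropy \<mu> (word_join X f \<xi> w)) = (\<Sum>w\<in>words m n. entropy_along w)"
      by (intro sum.cong partition_entropy_word_join) (auto simp: words_def)
    then show ?thesis by (simp add: mean_entropy_def)
  qed simp
  then show ?thesis
    using convergent_LIMSEQ_iff[THEN iffD1, OF conv] unfolding measure_entropy_wrt_def by simp
qed

end

section \<open>Blocks, compact approximations and the weights of itineraries\<close>

text \<open>
  The distance to \<open>B\<close> attains its minimum on \<open>A\<close>.
\<close>

lemma compact_separated:
  fixes A B :: "'a::metric_space set"
  assumes "compact A" "compact B" "A \<inter> B = {}"
  shows "\<exists>d>0. \<forall>x\<in>A. \<forall>y\<in>B. d \<le> dist x y"
proof (cases "A = {} \<or> B = {}")
  case False
  have "continuous_on A (\<lambda>x. infdist x B)" by (intro continuous_intros)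
  from continuous_attains_inf[OF assms(1) _ this] False
  obtain x0 where x0: "x0 \<in> A" "\<And>x. x \<in> A \<Longrightarrow> infdist x0 B \<le> infdist x B"
    by blast
  have "infdist x0 B \<noteq> 0"
    using in_closed_iff_infdist_zero[of B x0] compact_imp_closed[OF assms(2)] False x0(1) assms(3) by auto
  then have "infdist x0 B > 0" using infdist_nonneg[of x0 B] by linarith
  then show ?thesis
    using x0(2) infdist_le[of _ B] by (meson order_trans)
qed (auto intro: zero_less_one)

context partitioned_system
begin

lemma card_labels_pos: "real (card (labels N)) > 0"
  using labels_nonempty by (simp add: card_gt_0_iff)

text \<open>
  A block of length \<open>N\<close> has at most \<open>card (labels N)\<close> itineraries, so specifying one costs at most
  \<open>ln (card (labels N))\<close>. The compact sets are chosen so large that paying this cost only for points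
  outside of them amounts to at most \<open>1\<close> on average, whatever \<open>N\<close> is.
\<close>

lemma compact_approximation_of_cylinders:
  obtains K where
    "\<And>u a. u \<in> words m N \<Longrightarrow> a \<in> labels N \<Longrightarrow> compact (K u a) \<and> K u a \<subseteq> cylinder u a"
    "\<And>u. u \<in> words m N \<Longrightarrow> prob (X - (\<Union>a\<in>labels N. K u a)) * ln (card (labels N)) \<le> 1"
proof -
  define c where "c = real (card (labels N))"
  have c: "c \<ge> 1"
    using card_labels_pos[of N] by (simp add: c_def Suc_le_eq)
  \<comment> \<open>The \<open>c\<close> cylinders together lose at most \<open>c * \<delta>\<close>, and \<open>c * \<delta> * ln c = ln c / (ln c + 1) \<le> 1\<close>.\<close>
  define \<delta> where "\<delta> = 1 / (c * (ln c + 1))"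
  have lnc: "ln c \<ge> 0" using c by simp
  then have "c * (ln c + 1) > 0" using c by (intro mult_pos_pos) linarith+
  then have \<delta>: "\<delta> > 0" by (simp add: \<delta>_def)
  have sets: "cylinder u a \<in> sets \<mu>" if "u \<in> words m N" "a \<in> labels N" for u a
    using that cylinder_sets[of u a] by (auto simp: words_def)
  have "\<forall>u a. u \<in> words m N \<and> a \<in> labels N \<longrightarrow>
      (\<exists>K. compact K \<and> K \<subseteq> cylinder u a \<and> prob (cylinder u a - K) < \<delta>)"
    using compact_inner_approximation[OF finite_measure_axioms sets_eq compact sets \<delta>] by blast
  then obtain K where K: "\<And>u a. u \<in> words m N \<Longrightarrow> a \<in> labels N \<Longrightarrow>
      compact (K u a) \<and> K u a \<subseteq> cylinder u a \<and> prob (cylinder u a - K u a) < \<delta>"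
    by metis
  have "prob (X - (\<Union>a\<in>labels N. K u a)) * ln c \<le> 1" if u: "u \<in> words m N" for u
  proof -
    have meas: "cylinder u a - K u a \<in> sets \<mu>" if "a \<in> labels N" for a
    proof -
      have "K u a \<in> sets (restrict_space borel X)"
        using K[OF u that] compact_imp_closed[OF compact] sets[OF u that] sets.sets_into_space
        by (subst sets_restrict_space_iff) (auto simp: cylinder_def borel_compact)
      then show ?thesis using sets[OF u that] sets_eq by auto
    qed
    have "X - (\<Union>a\<in>labels N. K u a) \<subseteq> (\<Union>a\<in>labels N. cylinder u a - K u a)"
      using u itinerary_in_labels[of u] by (auto simp: words_def cylinder_def)
    then have "prob (X - (\<Union>a\<in>labels N. K u a)) \<le> prob (\<Union>a\<in>labels N. cylinder u a - K u a)"
      using meas by (intro finite_measure_mono) auto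
    also have "\<dots> \<le> (\<Sum>a\<in>labels N. prob (cylinder u a - K u a))"
      using meas by (intro finite_measure_subadditive_finite) auto
    also have "\<dots> \<le> (\<Sum>a\<in>labels N. \<delta>)"
      using K u by (intro sum_mono) (auto intro: less_imp_le)
    also have "\<dots> = c * \<delta>" by (simp add: c_def)
    finally have "prob (X - (\<Union>a\<in>labels N. K u a)) * ln c \<le> c * \<delta> * ln c"
      using lnc by (rule mult_right_mono)
    also have "\<dots> = ln c / (ln c + 1)" using c by (simp add: \<delta>_def)
    also have "\<dots> \<le> 1" using lnc by simp
    finally show ?thesis .
  qed
  with K that show ?thesis unfolding c_def by blast
qed

lemma eventually_separated:
  assumes K: "\<And>u a. u \<in> words m N \<Longrightarrow> a \<in> labels N \<Longrightarrow> compact (K u a) \<and> K u a \<subseteq> cylinder u a"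
  shows "\<forall>\<^sub>F \<epsilon> in at_right 0. \<forall>u\<in>words m N. \<forall>a\<in>labels N. \<forall>b\<in>labels N. a \<noteq> b \<longrightarrow>
    (\<forall>x\<in>K u a. \<forall>y\<in>K u b. 2 * \<epsilon> \<le> dist x y)"
proof (intro eventually_ball_finite finite_words finite_labels ballI)
  fix u a b assume uab: "u \<in> words m N" "a \<in> labels N" "b \<in> labels N"
  show "\<forall>\<^sub>F \<epsilon> in at_right 0. a \<noteq> b \<longrightarrow> (\<forall>x\<in>K u a. \<forall>y\<in>K u b. 2 * \<epsilon> \<le> dist x y)"
  proof (cases "a = b")
    case False
    then have "K u a \<inter> K u b = {}"
      using K[OF uab(1,2)] K[OF uab(1,3)] by (auto simp: cylinder_def)
    then obtain d where d: "d > 0" "\<forall>x\<in>K u a. \<forall>y\<in>K u b. d \<le> dist x y"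
      using compact_separated[of "K u a" "K u b"] K[OF uab(1,2)] K[OF uab(1,3)] by metis
    have "\<forall>\<^sub>F \<epsilon> in at_right 0. \<epsilon> < d / 2"
      using d(1) by (intro order_tendstoD[OF tendsto_ident_at]) simp
    then show ?thesis
      by eventually_elim (use d(2) in force)
  qed simp
qed

text \<open>
  The weights guess the itinerary of a point \<open>x\<close> from a nearby orbit. Near \<open>z\<close>, an itinerary \<open>a\<close> of a
  block \<open>u\<close> gets weight at least \<open>1\<close> if its compact set \<open>K u a\<close> comes within \<open>\<epsilon>\<close> of \<open>z\<close>, and every
  itinerary gets the small uniform weight \<open>1 / card (labels N)\<close> as an insurance for points outside the
  compact sets. For a word of \<open>q\<close> blocks,
  \<open>path_weight\<close> multiplies the weights of the blocks, from the left, along the orbit of \<open>y\<close>; \<open>penalty\<close> adds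
  up the logarithmic cost of the blocks at which the orbit of \<open>x\<close> misses the compact sets.
\<close>

definition block_weight ::
  "nat \<Rightarrow> (nat list \<Rightarrow> 'a set list \<Rightarrow> 'a set) \<Rightarrow> real \<Rightarrow> nat list \<Rightarrow> 'a \<Rightarrow> 'a set list \<Rightarrow> real" where
  "block_weight N K \<epsilon> u z a =
     1 / card (labels N) + (if \<exists>x\<in>K u a. dist x z < \<epsilon> then 1 else 0)"

primrec path_weight ::
  "nat \<Rightarrow> (nat list \<Rightarrow> 'a set list \<Rightarrow> 'a set) \<Rightarrow> real \<Rightarrow> nat \<Rightarrow> nat list \<Rightarrow> 'a \<Rightarrow> 'a set list \<Rightarrow> real" where
  "path_weight N K \<epsilon> 0 w y s = 1"
| "path_weight N K \<epsilon> (Suc q) w y s =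
     block_weight N K \<epsilon> (take N w) (word_map f (drop N w) y) (take N s)
     * path_weight N K \<epsilon> q (drop N w) y (drop N s)"

primrec penalty ::
  "nat \<Rightarrow> (nat list \<Rightarrow> 'a set list \<Rightarrow> 'a set) \<Rightarrow> nat \<Rightarrow> nat list \<Rightarrow> 'a \<Rightarrow> real" where
  "penalty N K 0 w x = 0"
| "penalty N K (Suc q) w x =
     (if word_map f (drop N w) x \<in> (\<Union>a\<in>labels N. K (take N w) a) then 0 else ln (card (labels N)))
     + penalty N K q (drop N w) x"

lemma block_weight_pos: "block_weight N K \<epsilon> u z a > 0"
  unfolding block_weight_def using card_labels_pos[of N] by (simp add: add_pos_nonneg)

lemma path_weight_pos: "path_weight N K \<epsilon> q w y s > 0"
  by (induction q arbitrary: w s) (auto intro!: mult_pos_pos block_weight_pos)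

lemma words_take_drop:
  assumes "w \<in> words m (Suc q * N)"
  shows "take N w \<in> words m N" "drop N w \<in> words m (q * N)"
  using assms by (auto simp: words_def dest: in_set_takeD in_set_dropD)

text \<open>
  By the separation of the compact sets, the ball of radius \<open>\<epsilon>\<close> about \<open>z\<close> meets at most one of them. This
  contributes \<open>1\<close>, and the uniform part contributes \<open>1\<close>.
\<close>

lemma sum_block_weight_le:
  assumes sep: "\<And>a b x y. a \<in> labels N \<Longrightarrow> b \<in> labels N \<Longrightarrow> a \<noteq> b \<Longrightarrow>
    x \<in> K u a \<Longrightarrow> y \<in> K u b \<Longrightarrow> 2 * \<epsilon> \<le> dist x y"
  shows "(\<Sum>a\<in>labels N. block_weight N K \<epsilon> u z a) \<le> 2"
proof -
  let ?T = "{a \<in> labels N. \<exists>x\<in>K u a. dist x z < \<epsilon>}"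
  have "a = b" if ab: "a \<in> ?T" "b \<in> ?T" for a b
  proof (rule ccontr)
    assume ne: "a \<noteq> b"
    from ab obtain x y where xy: "x \<in> K u a" "y \<in> K u b" "dist x z < \<epsilon>" "dist y z < \<epsilon>" by auto
    then have "dist x y < 2 * \<epsilon>" using dist_triangle2[of x y z] by linarith
    with sep[OF _ _ ne xy(1,2)] ab show False by auto
  qed
  then have "card ?T \<le> 1" by (subst card_le_Suc0_iff_eq[unfolded One_nat_def[symmetric]]) auto
  moreover have "(\<Sum>a\<in>labels N. if \<exists>x\<in>K u a. dist x z < \<epsilon> then 1 else 0) = real (card ?T)"
    by (simp add: sum.If_cases Int_def)
  ultimately show ?thesis
    unfolding block_weight_def using card_labels_pos[of N] by (simp add: sum.distrib)
qed

lemma sum_path_weight_le: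
  assumes sep: "\<forall>u\<in>words m N. \<forall>a\<in>labels N. \<forall>b\<in>labels N. a \<noteq> b \<longrightarrow>
      (\<forall>x\<in>K u a. \<forall>y\<in>K u b. 2 * \<epsilon> \<le> dist x y)"
    and w: "w \<in> words m (q * N)"
  shows "(\<Sum>s\<in>labels (q * N). path_weight N K \<epsilon> q w y s) \<le> 2 ^ q"
  using w
proof (induction q arbitrary: w)
  case 0
  have "labels 0 = {[]}" by (auto simp: labels_def)
  then show ?case by simp
next
  case (Suc q)
  note td = words_take_drop[OF Suc.prems]
  let ?z = "word_map f (drop N w) y"
  have "(\<Sum>s\<in>labels (Suc q * N). path_weight N K \<epsilon> (Suc q) w y s) =
      (\<Sum>a\<in>labels N. \<Sum>b\<in>labels (q * N).
        block_weight N K \<epsilon> (take N w) ?z a * path_weight N K \<epsilon> q (drop N w) y b)"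
    unfolding mult_Suc sum_labels_append by (intro sum.cong) (auto simp: labels_def)
  also have "\<dots> = (\<Sum>a\<in>labels N. block_weight N K \<epsilon> (take N w) ?z a) *
      (\<Sum>b\<in>labels (q * N). path_weight N K \<epsilon> q (drop N w) y b)"
    by (simp add: sum_product)
  also have "\<dots> \<le> 2 * 2 ^ q"
    using Suc.IH[OF td(2)] sep td(1) path_weight_pos
    by (intro mult_mono sum_block_weight_le sum_nonneg) (auto intro: less_imp_le)
  finally show ?case by simp
qed

text \<open>
  When the orbit of \<open>x\<close> enters a block in one of the compact sets, this is the one labelled by the block
  of the itinerary of \<open>x\<close>, and it is within \<open>\<epsilon>\<close> of the orbit of \<open>y\<close>; otherwise the uniform weight remains.
\<close>

lemma path_weight_ge:
  assumes K: "\<And>u a. u \<in> words m N \<Longrightarrow> a \<in> labels N \<Longrightarrow> K u a \<subseteq> cylinder u a"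
    and N: "N \<ge> 1" and w: "w \<in> words m (q * N)" and x: "x \<in> X"
    and close: "\<And>w'. strict_suffix w' w \<Longrightarrow> dist (word_map f w' x) (word_map f w' y) < \<epsilon>"
  shows "exp (- penalty N K q w x) \<le> path_weight N K \<epsilon> q w y (itinerary f \<xi> w x)"
  using w close
proof (induction q arbitrary: w)
  case (Suc q)
  note td = words_take_drop[OF Suc.prems(1)]
  let ?u = "take N w" and ?v = "drop N w"
  have lw: "length w = Suc q * N" using Suc.prems by (simp add: words_def)
  have split: "itinerary f \<xi> w x = itinerary f \<xi> ?u (word_map f ?v x) @ itinerary f \<xi> ?v x"
    using itinerary_append[of f \<xi> ?u ?v x] by simp
  have len: "length (itinerary f \<xi> ?u (word_map f ?v x)) = N" using lw by simp
  \<comment> \<open>Only the positions at which blocks start are compared, and they are proper suffixes as \<open>N \<ge> 1\<close>.\<close>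
  have "strict_suffix ?v w"
    using N lw by (auto simp: strict_suffix_def suffix_drop dest!: arg_cong[of _ _ length])
  then have near: "dist (word_map f ?v x) (word_map f ?v y) < \<epsilon>" by (rule Suc.prems)
  have close': "dist (word_map f w' x) (word_map f w' y) < \<epsilon>" if "strict_suffix w' ?v" for w'
    using Suc.prems(2)[of w'] strict_suffix_append[OF that, of ?u] by simp
  let ?r = "if word_map f ?v x \<in> (\<Union>a\<in>labels N. K ?u a) then 0 else ln (card (labels N))"
  have "exp (- ?r) \<le>
      block_weight N K \<epsilon> ?u (word_map f ?v y) (itinerary f \<xi> ?u (word_map f ?v x))"
  proof (cases "word_map f ?v x \<in> (\<Union>a\<in>labels N. K ?u a)")
    case True
    then obtain a where a: "a \<in> labels N" "word_map f ?v x \<in> K ?u a" by auto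
    then have "itinerary f \<xi> ?u (word_map f ?v x) = a" using K[OF td(1) a(1)] by (auto simp: cylinder_def)
    then show ?thesis using a near card_labels_pos[of N] True by (auto simp: block_weight_def)
  next
    case False
    then show ?thesis using card_labels_pos[of N] by (simp add: block_weight_def exp_minus inverse_eq_divide)
  qed
  then have "exp (- ?r) * exp (- penalty N K q ?v x) \<le>
      block_weight N K \<epsilon> ?u (word_map f ?v y) (itinerary f \<xi> ?u (word_map f ?v x))
      * path_weight N K \<epsilon> q ?v y (itinerary f \<xi> ?v x)"
    using Suc.IH[OF td(2) close'] block_weight_pos by (intro mult_mono) (auto intro: less_imp_le)
  then show ?case
    using len by (simp add: split flip: exp_add)
qed simp

text \<open>
  By invariance each block contributes the cost of a single block at time \<open>0\<close>, which is at most \<open>1\<close>.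
\<close>

lemma integral_penalty_le:
  assumes K: "\<And>u a. u \<in> words m N \<Longrightarrow> a \<in> labels N \<Longrightarrow> compact (K u a) \<and> K u a \<subseteq> cylinder u a"
    and small: "\<And>u. u \<in> words m N \<Longrightarrow> prob (X - (\<Union>a\<in>labels N. K u a)) * ln (card (labels N)) \<le> 1"
    and w: "w \<in> words m (q * N)"
  shows "integrable \<mu> (penalty N K q w) \<and> (\<integral>x. penalty N K q w x \<partial>\<mu>) \<le> q"
  using w
proof (induction q arbitrary: w)
  case 0
  have "penalty N K 0 w = (\<lambda>_. 0)" by (simp add: fun_eq_iff)
  then show ?case by simp
next
  case (Suc q)
  note td = words_take_drop[OF Suc.prems]
  define G where "G = X - (\<Union>a\<in>labels N. K (take N w) a)"
  let ?l = "ln (card (labels N))"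
  have "X - (\<Union>a\<in>labels N. K (take N w) a) \<in> sets borel"
    using K[OF td(1)] compact_imp_closed[OF compact]
    by (intro sets.Diff sets.finite_UN) (auto simp: borel_compact)
  then have G: "G \<in> sets \<mu>"
    unfolding sets_eq G_def using compact_imp_closed[OF compact] by (subst sets_restrict_space_iff) auto
  have v: "set (drop N w) \<subseteq> {..<m}" using td by (simp add: words_def)
  let ?g = "\<lambda>z. indicator G z * ?l"
  have g: "integrable \<mu> ?g"
    using G by (intro integrable_mult_left integrable_real_indicator) (auto simp: less_top[symmetric])
  have "(\<integral>z. ?g z \<partial>\<mu>) = prob G * ?l"
    using sets.sets_into_space[OF G] by (simp add: Int_absorb2)
  then have g1: "(\<integral>z. ?g z \<partial>\<mu>) \<le> 1" using small[OF td(1)] unfolding G_def by linarith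
  have eq: "penalty N K (Suc q) w x = ?g (word_map f (drop N w) x) + penalty N K q (drop N w) x"
    if "x \<in> space \<mu>" for x
    using that word_map_in[OF v] by (auto simp: G_def)
  have int: "integrable \<mu> (\<lambda>x. ?g (word_map f (drop N w) x))"
    by (rule integrable_word_map[OF v g])
  have int': "integrable \<mu> (\<lambda>x. ?g (word_map f (drop N w) x) + penalty N K q (drop N w) x)"
    using Suc.IH[OF td(2)] int by (intro Bochner_Integration.integrable_add) auto
  have "(\<integral>x. penalty N K (Suc q) w x \<partial>\<mu>) =
      (\<integral>x. ?g (word_map f (drop N w) x) + penalty N K q (drop N w) x \<partial>\<mu>)"
    using eq by (intro Bochner_Integration.integral_cong) auto
  also have "\<dots> = (\<integral>x. ?g (word_map f (drop N w) x) \<partial>\<mu>) + (\<integral>x. penalty N K q (drop N w) x \<partial>\<mu>)"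
    using Suc.IH[OF td(2)] int by (intro Bochner_Integration.integral_add) auto
  also have "(\<integral>x. ?g (word_map f (drop N w) x) \<partial>\<mu>) = (\<integral>x. ?g x \<partial>\<mu>)"
    by (rule integral_word_map[OF v borel_measurable_integrable[OF g]])
  finally have "(\<integral>x. penalty N K (Suc q) w x \<partial>\<mu>) \<le> Suc q"
    using g1 Suc.IH[OF td(2)] by simp
  moreover have "integrable \<mu> (penalty N K (Suc q) w)"
    using int' eq by (subst Bochner_Integration.integrable_cong[OF refl, of _ _
      "\<lambda>x. ?g (word_map f (drop N w) x) + penalty N K q (drop N w) x"]) auto
  ultimately show ?case by blast
qed

section \<open>Spanning sets and entropy\<close>

lemma word_sum_diff_le:
  fixes \<tau> :: real
  assumes "\<And>w'. strict_suffix w' w \<Longrightarrow> \<phi> (word_map f w' x) - \<phi> (word_map f w' y) \<le> \<tau>"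
  shows "word_sum f w \<phi> x - word_sum f w \<phi> y \<le> length w * \<tau>"
  using assms
proof (induction w)
  case (Cons i w)
  have "strict_suffix w (i # w)" "\<And>w'. strict_suffix w' w \<Longrightarrow> strict_suffix w' (i # w)"
    using strict_suffixes_Cons[of i w] by blast+
  with Cons have "word_sum f w \<phi> x - word_sum f w \<phi> y \<le> length w * \<tau>"
    "\<phi> (word_map f w x) - \<phi> (word_map f w y) \<le> \<tau>" by auto
  then show ?case by (simp add: word_sum_Cons algebra_simps)
qed simp

text \<open>
  The central estimate. The weight of an itinerary is the sum over \<open>y \<in> E\<close> of \<open>exp (word_sum f w \<phi> y)\<close>
  times its \<open>path_weight\<close> along the orbit of \<open>y\<close>. The total mass is at most \<open>2 ^ q\<close> times the sum of the
  exponentials. On the other hand, each \<open>x\<close> is \<open>\<epsilon>\<close>-close to some \<open>y \<in> E\<close>, and this single summand already shows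
  that the itinerary of \<open>x\<close> has weight at least \<open>exp (word_sum f w \<phi> x - q N \<tau> - penalty x)\<close>. Gibbs'
  inequality and integration give the claim. The loss \<open>q (1 + ln 2)\<close> is proportional to the number of
  blocks, not to the number \<open>q N\<close> of letters.
\<close>

lemma entropy_along_le_spanning:
  fixes \<tau> :: real
  assumes K: "\<And>u a. u \<in> words m N \<Longrightarrow> a \<in> labels N \<Longrightarrow> compact (K u a) \<and> K u a \<subseteq> cylinder u a"
    and small: "\<And>u. u \<in> words m N \<Longrightarrow> prob (X - (\<Union>a\<in>labels N. K u a)) * ln (card (labels N)) \<le> 1"
    and sep: "\<forall>u\<in>words m N. \<forall>a\<in>labels N. \<forall>b\<in>labels N. a \<noteq> b \<longrightarrow>
      (\<forall>x\<in>K u a. \<forall>y\<in>K u b. 2 * \<epsilon> \<le> dist x y)"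
    and N: "N \<ge> 1" and w: "w \<in> words m (q * N)"
    and \<phi>: "continuous_on X \<phi>"
    and osc: "\<And>x y. x \<in> X \<Longrightarrow> y \<in> X \<Longrightarrow> dist x y < \<epsilon> \<Longrightarrow> \<phi> x - \<phi> y \<le> \<tau>"
    and E: "finite E" "spanning X f w \<epsilon> E"
  shows "entropy_along w + (q * N) * (\<integral>x. \<phi> x \<partial>\<mu>) - q * N * \<tau> - q * (1 + ln 2)
    \<le> ln (\<Sum>y\<in>E. exp (word_sum f w \<phi> y))"
proof -
  let ?S = "word_sum f w \<phi>" and ?n = "q * N"
  have wm: "set w \<subseteq> {..<m}" and lw: "length w = ?n" using w by (auto simp: words_def)
  define Q where "Q s = (\<Sum>y\<in>E. exp (?S y) * path_weight N K \<epsilon> q w y s)" for s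
  define Z where "Z = (\<Sum>y\<in>E. exp (?S y))"
  have EX: "E \<subseteq> X" using E by (simp add: spanning_def)
  have Ene: "E \<noteq> {}" using E(2) not_empty by (auto simp: spanning_def)
  have Zpos: "Z > 0" unfolding Z_def using E(1) Ene by (intro sum_pos) auto
  have Qpos: "Q s > 0" for s
    unfolding Q_def using E(1) Ene by (intro sum_pos) (auto intro!: mult_pos_pos path_weight_pos)
  have "(\<Sum>s\<in>labels ?n. Q s) = (\<Sum>y\<in>E. exp (?S y) * (\<Sum>s\<in>labels ?n. path_weight N K \<epsilon> q w y s))"
    unfolding Q_def sum_distrib_left by (rule sum.swap)
  also have "\<dots> \<le> (\<Sum>y\<in>E. exp (?S y) * 2 ^ q)"
    by (intro sum_mono mult_left_mono sum_path_weight_le[OF sep w]) auto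
  finally have QZ: "(\<Sum>s\<in>labels ?n. Q s) \<le> 2 ^ q * Z" by (simp add: Z_def mult.commute sum_distrib_left)
  have lower: "?S x - ?n * \<tau> - penalty N K q w x \<le> ln (Q (itinerary f \<xi> w x))" if x: "x \<in> X" for x
  proof -
    obtain y where y: "y \<in> E" "word_dist f w x y < \<epsilon>" using E(2) x by (auto simp: spanning_def)
    note close = word_dist_lessD[OF y(2)]
    have "?S x - ?S y \<le> length w * \<tau>"
    proof (rule word_sum_diff_le)
      fix w' assume w': "strict_suffix w' w"
      then have "set w' \<subseteq> {..<m}" using strict_suffix_set_subset wm by blast
      then show "\<phi> (word_map f w' x) - \<phi> (word_map f w' y) \<le> \<tau>"
        using x y(1) EX close[OF w'] by (intro osc word_map_in) auto
    qed
    then have "exp (?S x - ?n * \<tau>) * exp (- penalty N K q w x) \<le>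
        exp (?S y) * path_weight N K \<epsilon> q w y (itinerary f \<xi> w x)"
      using K close by (intro mult_mono path_weight_ge N w x) (auto simp: lw less_imp_le path_weight_pos)
    also have "\<dots> \<le> Q (itinerary f \<xi> w x)"
      unfolding Q_def using E(1) y(1) path_weight_pos
      by (intro member_le_sum) (auto intro!: mult_nonneg_nonneg less_imp_le)
    finally show ?thesis
      using Qpos by (subst ln_ge_iff) (auto simp flip: exp_add)
  qed
  have "entropy_along w \<le> ln (2 ^ q * Z) - (\<Sum>s\<in>labels ?n. prob (cylinder w s) * ln (Q s))"
    unfolding entropy_along_def lw
    using sum_prob_cylinder[OF wm] QZ Qpos lw
    by (intro gibbs_inequality) (auto intro: less_imp_le simp: less_imp_neq[THEN not_sym])
  also have "(\<Sum>s\<in>labels ?n. prob (cylinder w s) * ln (Q s)) = (\<integral>x. ln (Q (itinerary f \<xi> w x)) \<partial>\<mu>)"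
    using sum_cylinder_eq_integral(2)[OF wm, of "\<lambda>s. ln (Q s)"] lw by simp
  finally have H: "entropy_along w \<le> ln (2 ^ q * Z) - (\<integral>x. ln (Q (itinerary f \<xi> w x)) \<partial>\<mu>)" .
  note pen = integral_penalty_le[OF K small w]
  note S = integral_word_sum[OF wm \<phi>]
  have "?n * (\<integral>x. \<phi> x \<partial>\<mu>) - ?n * \<tau> - (\<integral>x. penalty N K q w x \<partial>\<mu>) =
      (\<integral>x. ?S x - ?n * \<tau> - penalty N K q w x \<partial>\<mu>)"
    using pen S lw prob_space by simp
  also have "\<dots> \<le> (\<integral>x. ln (Q (itinerary f \<xi> w x)) \<partial>\<mu>)"
    using pen S sum_cylinder_eq_integral(1)[OF wm, of "\<lambda>s. ln (Q s)"] lower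
    by (intro integral_mono) auto
  finally have "?n * (\<integral>x. \<phi> x \<partial>\<mu>) - ?n * \<tau> - q \<le> (\<integral>x. ln (Q (itinerary f \<xi> w x)) \<partial>\<mu>)"
    using pen by simp
  moreover have "ln (2 ^ q * Z) = q * ln 2 + ln Z" using Zpos by (simp add: ln_mult ln_realpow)
  ultimately show ?thesis using H unfolding Z_def by (simp add: algebra_simps)
qed

end

section \<open>Convergence of pressure and topological entropy at small scales\<close>

text \<open>
  \<^const>\<open>pressure\<close> and \<^const>\<open>topological_entropy\<close> are defined by \<^const>\<open>Lim\<close>, so the convergence as
  \<open>\<epsilon>\<close> tends to \<open>0\<close> has to be proved; it comes from monotonicity.
\<close>

lemma antimono_tendsto_SUP_at_right:
  fixes g :: "real \<Rightarrow> 'b::{complete_linorder, linorder_topology}"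
  assumes anti: "\<And>\<delta> \<epsilon>. 0 < \<delta> \<Longrightarrow> \<delta> \<le> \<epsilon> \<Longrightarrow> g \<epsilon> \<le> g \<delta>"
  shows "(g \<longlongrightarrow> (SUP \<epsilon>\<in>{0<..}. g \<epsilon>)) (at_right 0)"
proof (rule order_tendstoI)
  fix l assume "l < (SUP \<epsilon>\<in>{0<..}. g \<epsilon>)"
  then obtain \<epsilon> where \<epsilon>: "\<epsilon> > 0" "l < g \<epsilon>" by (auto simp: less_SUP_iff)
  have "\<forall>\<^sub>F \<delta> in at_right 0. \<delta> < \<epsilon>"
    using \<epsilon>(1) by (intro order_tendstoD[OF tendsto_ident_at]) simp
  then show "\<forall>\<^sub>F \<delta> in at_right 0. l < g \<delta>"
    using eventually_at_right_less[of 0]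
    by eventually_elim (metis \<epsilon>(2) anti less_imp_le less_le_trans)
next
  fix u assume "(SUP \<epsilon>\<in>{0<..}. g \<epsilon>) < u"
  then have "g \<delta> < u" if "0 < \<delta>" for \<delta>
    using that by (intro le_less_trans[OF SUP_upper, of \<delta> _ g u]) auto
  then show "\<forall>\<^sub>F \<delta> in at_right 0. g \<delta> < u"
    using eventually_at_right_less[of "0::real"] by (simp add: eventually_mono)
qed

lemma ln_ennreal_mono: "p \<le> q \<Longrightarrow> ln_ennreal p \<le> ln_ennreal q"
proof -
  assume pq: "p \<le> q"
  show ?thesis
  proof (cases "p = 0 \<or> q = \<infinity>")
    case False
    then have fin: "p < top" "q < top" "p \<noteq> 0" "q \<noteq> 0"
      using pq by (auto simp: less_top[symmetric] top_unique)
    then have "0 < enn2real p" "enn2real p \<le> enn2real q"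
      using pq by (auto simp: enn2real_positive_iff zero_less_iff_neq_zero intro!: enn2real_mono)
    then show ?thesis using fin by (auto simp: ln_ennreal_def)
  qed (auto simp: ln_ennreal_def)
qed

lemma ln_ennreal_ennreal: "r > 0 \<Longrightarrow> ln_ennreal (ennreal r) = ereal (ln r)"
  by (auto simp: ln_ennreal_def ennreal_eq_0_iff)

lemma divide_ennreal_of_nat: "k > 0 \<Longrightarrow> r \<ge> 0 \<Longrightarrow> ennreal r / of_nat k = ennreal (r / real k)"
  by (simp add: divide_ennreal ennreal_of_nat_eq_real_of_nat)

definition pressure_at_scale ::
  "'a::metric_space set \<Rightarrow> nat \<Rightarrow> (nat \<Rightarrow> 'a \<Rightarrow> 'a) \<Rightarrow> ('a \<Rightarrow> real) \<Rightarrow> real \<Rightarrow> ereal" where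
  "pressure_at_scale X m f \<phi> \<epsilon> =
     limsup (\<lambda>n. ereal (1 / real n) * ln_ennreal (Q_level X m f \<phi> \<epsilon> n))"

lemma spanning_mono: "spanning X f w \<delta> E \<Longrightarrow> \<delta> \<le> \<epsilon> \<Longrightarrow> spanning X f w \<epsilon> E"
  unfolding spanning_def by (meson less_le_trans)

lemma pressure_at_scale_antimono:
  assumes "\<delta> \<le> \<epsilon>"
  shows "pressure_at_scale X m f \<phi> \<epsilon> \<le> pressure_at_scale X m f \<phi> \<delta>"
proof -
  have "Q_word X f \<phi> \<epsilon> w \<le> Q_word X f \<phi> \<delta> w" for w
    unfolding Q_word_def using spanning_mono[OF _ assms] by (intro INF_superset_mono) auto
  then have "Q_level X m f \<phi> \<epsilon> n \<le> Q_level X m f \<phi> \<delta> n" for n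
    unfolding Q_level_def by (intro divide_right_mono_ennreal sum_mono)
  then show ?thesis
    unfolding pressure_at_scale_def
    by (intro Limsup_mono always_eventually allI ereal_mult_left_mono ln_ennreal_mono) auto
qed

lemma pressure_at_scale_tendsto:
  "(pressure_at_scale X m f \<phi> \<longlongrightarrow> pressure X m f \<phi>) (at_right 0)"
proof -
  have lim: "(pressure_at_scale X m f \<phi> \<longlongrightarrow> (SUP \<epsilon>\<in>{0<..}. pressure_at_scale X m f \<phi> \<epsilon>)) (at_right 0)"
    by (intro antimono_tendsto_SUP_at_right pressure_at_scale_antimono)
  have "pressure X m f \<phi> = (SUP \<epsilon>\<in>{0<..}. pressure_at_scale X m f \<phi> \<epsilon>)"
    unfolding pressure_def pressure_at_scale_def[symmetric]
    by (rule tendsto_Lim[OF trivial_limit_at_right_real lim])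
  with lim show ?thesis by simp
qed

context invariant_system
begin

lemma X_nonempty: "X \<noteq> {}"
  using not_empty by simp

lemma words_nonempty: "words m n \<noteq> {}"
  using card_words[of m n] m_pos by (metis card.empty power_eq_0_iff not_one_le_zero)

text \<open>
  All the finitely many maps that enter the distance are uniformly continuous on \<open>X\<close>, so a sufficiently
  fine finite net is spanning. In particular the least cardinality in \<^const>\<open>min_spanning\<close> is attained.
\<close>

lemma exists_finite_spanning:
  assumes w: "set w \<subseteq> {..<m}" "w \<noteq> []" and \<epsilon>: "\<epsilon> > 0"
  shows "\<exists>E. finite E \<and> spanning X f w \<epsilon> E"
proof -
  let ?S = "{w'. strict_suffix w' w}"
  have "\<forall>\<^sub>F \<delta> in at_right 0. \<forall>w'\<in>?S. \<forall>x\<in>X. \<forall>y\<in>X.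
      dist x y < \<delta> \<longrightarrow> dist (word_map f w' x) (word_map f w' y) < \<epsilon>"
  proof (rule eventually_ball_finite[OF finite_strict_suffixes], rule ballI)
    fix w' assume "w' \<in> ?S"
    then have "set w' \<subseteq> {..<m}" using w strict_suffix_set_subset by blast
    then have "uniformly_continuous_on X (word_map f w')"
      using compact_uniformly_continuous continuous_word_map compact by blast
    then obtain d where d: "d > 0"
      "\<And>x y. x \<in> X \<Longrightarrow> y \<in> X \<Longrightarrow> dist x y < d \<Longrightarrow> dist (word_map f w' x) (word_map f w' y) < \<epsilon>"
      unfolding uniformly_continuous_on_def using \<epsilon> by metis
    have "\<forall>\<^sub>F \<delta> in at_right 0. \<delta> < d"
      using d(1) by (intro order_tendstoD[OF tendsto_ident_at]) simp
    then show "\<forall>\<^sub>F \<delta> in at_right 0. \<forall>x\<in>X. \<forall>y\<in>X.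
      dist x y < \<delta> \<longrightarrow> dist (word_map f w' x) (word_map f w' y) < \<epsilon>"
      by eventually_elim (meson d(2) less_trans)
  qed
  then have "\<forall>\<^sub>F \<delta> in at_right 0. 0 < \<delta> \<and> (\<forall>w'\<in>?S. \<forall>x\<in>X. \<forall>y\<in>X.
      dist x y < \<delta> \<longrightarrow> dist (word_map f w' x) (word_map f w' y) < \<epsilon>)"
    by (intro eventually_conj eventually_at_right_less)
  from eventually_happens'[OF trivial_limit_at_right_real this]
  obtain \<delta> :: real where \<delta>: "\<delta> > 0" and close: "\<And>w' x y. w' \<in> ?S \<Longrightarrow> x \<in> X \<Longrightarrow> y \<in> X \<Longrightarrow>
      dist x y < \<delta> \<Longrightarrow> dist (word_map f w' x) (word_map f w' y) < \<epsilon>"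
    by (elim exE conjE) simp
  from seq_compact_imp_totally_bounded[OF compact_imp_seq_compact[OF compact], rule_format, OF \<delta>]
  obtain E where E: "finite E" "E \<subseteq> X" "X \<subseteq> (\<Union>y\<in>E. ball y \<delta>)"
    by blast
  have Sne: "?S \<noteq> {}" using w(2) by (auto intro!: exI[of _ "tl w"])
  have "\<exists>y\<in>E. word_dist f w x y < \<epsilon>" if "x \<in> X" for x
  proof -
    have "x \<in> (\<Union>y\<in>E. ball y \<delta>)" using E(3) that by blast
    then obtain y where y: "y \<in> E" "dist x y < \<delta>" by (auto simp: dist_commute)
    have "word_dist f w x y < \<epsilon>"
      unfolding word_dist_def
      using Sne close[OF _ that _ y(2)] E(2) y(1) by (subst Max_less_iff) auto
    with y(1) show ?thesis by blast
  qed
  then show ?thesis using E by (auto simp: spanning_def)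
qed

lemma min_spanning_works:
  assumes "set w \<subseteq> {..<m}" "w \<noteq> []" "\<epsilon> > 0"
  shows "\<exists>E. finite E \<and> spanning X f w \<epsilon> E \<and> card E = min_spanning X f \<epsilon> w"
proof -
  obtain E where "finite E \<and> spanning X f w \<epsilon> E \<and> card E = card E"
    using exists_finite_spanning[OF assms] by blast
  then have "\<exists>k E. finite E \<and> spanning X f w \<epsilon> E \<and> card E = k" by blast
  then show ?thesis unfolding min_spanning_def by (rule LeastI_ex)
qed

lemma Q_word_zero:
  assumes "set w \<subseteq> {..<m}" "w \<noteq> []" "\<epsilon> > 0"
  shows "Q_word X f (\<lambda>_. 0) \<epsilon> w = of_nat (min_spanning X f \<epsilon> w)"
proof (rule antisym)
  have one: "word_sum f w (\<lambda>_. 0) x = 0" for x by (simp add: word_sum_def)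
  obtain E where "finite E" "spanning X f w \<epsilon> E" "card E = min_spanning X f \<epsilon> w"
    using min_spanning_works[OF assms] by blast
  then show "Q_word X f (\<lambda>_. 0) \<epsilon> w \<le> of_nat (min_spanning X f \<epsilon> w)"
    unfolding Q_word_def by (intro INF_lower2[of E]) (auto simp: one)
  show "of_nat (min_spanning X f \<epsilon> w) \<le> Q_word X f (\<lambda>_. 0) \<epsilon> w"
    unfolding Q_word_def
  proof (rule INF_greatest)
    fix E assume E: "E \<in> {E. spanning X f w \<epsilon> E}"
    show "of_nat (min_spanning X f \<epsilon> w) \<le> (\<Sum>\<^sub>\<infinity>x\<in>E. ennreal (exp (word_sum f w (\<lambda>_. 0) x)))"
    proof (cases "finite E")
      case True
      then have "min_spanning X f \<epsilon> w \<le> card E"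
        unfolding min_spanning_def using E by (intro Least_le) auto
      then show ?thesis using True by (simp add: one)
    next
      case False
      then have "(\<Sum>\<^sub>\<infinity>x\<in>E. ennreal (exp (word_sum f w (\<lambda>_. 0) x))) = \<infinity>"
        by (intro infsum_superconst_infinite_ennreal[where b = 1]) (auto simp: one)
      then show ?thesis by simp
    qed
  qed
qed

lemma min_spanning_pos:
  assumes "set w \<subseteq> {..<m}" "w \<noteq> []" "\<epsilon> > 0"
  shows "min_spanning X f \<epsilon> w > 0"
proof -
  obtain E where E: "finite E" "spanning X f w \<epsilon> E" "card E = min_spanning X f \<epsilon> w"
    using min_spanning_works[OF assms] by blast
  then have "E \<noteq> {}" using X_nonempty by (auto simp: spanning_def)
  with E show ?thesis by (metis card_gt_0_iff)
qed

text \<open>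
  For \<open>\<phi> = 0\<close> a finite spanning set weighs its cardinality and an infinite one weighs \<open>\<infinity>\<close>, so the two
  expressions agree at every scale \<open>\<epsilon> > 0\<close> and every length \<open>n \<ge> 1\<close>.
\<close>

lemma topological_entropy_eq_pressure_zero:
  "topological_entropy X m f = pressure X m f (\<lambda>_. 0)"
proof -
  let ?h = "\<lambda>\<epsilon>. limsup (\<lambda>n. ereal (1 / real n * ln (1 / real (m ^ n) *
      (\<Sum>w\<in>words m n. real (min_spanning X f \<epsilon> w)))))"
  have eq: "?h \<epsilon> = pressure_at_scale X m f (\<lambda>_. 0) \<epsilon>" if "\<epsilon> > 0" for \<epsilon>
    unfolding pressure_at_scale_def
  proof (rule Limsup_eq[OF eventually_sequentiallyI[of 1]])
    fix n :: nat assume n: "n \<ge> 1"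
    have w: "set w \<subseteq> {..<m}" "w \<noteq> []" if "w \<in> words m n" for w
      using that n by (auto simp: words_def)
    let ?s = "\<Sum>w\<in>words m n. real (min_spanning X f \<epsilon> w)"
    have "?s > 0"
      using w \<open>\<epsilon> > 0\<close> words_nonempty by (intro sum_pos) (auto intro: min_spanning_pos)
    moreover have "Q_level X m f (\<lambda>_. 0) \<epsilon> n = ennreal (?s / real (m ^ n))"
    proof -
      have "(\<Sum>w\<in>words m n. Q_word X f (\<lambda>_. 0) \<epsilon> w) = (\<Sum>w\<in>words m n. ennreal (real (min_spanning X f \<epsilon> w)))"
        using w \<open>\<epsilon> > 0\<close> by (intro sum.cong refl) (simp add: Q_word_zero ennreal_of_nat_eq_real_of_nat)
      also have "\<dots> = ennreal ?s" by (rule sum_ennreal) simp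
      finally show ?thesis
        unfolding Q_level_def using m_pos by (simp add: divide_ennreal_of_nat sum_nonneg del: of_nat_power)
    qed
    ultimately show "ereal (1 / real n * ln (1 / real (m ^ n) * ?s)) =
        ereal (1 / real n) * ln_ennreal (Q_level X m f (\<lambda>_. 0) \<epsilon> n)"
      using m_pos by (simp add: ln_ennreal_ennreal)
  qed
  have "\<forall>\<^sub>F \<epsilon> in at_right 0. pressure_at_scale X m f (\<lambda>_. 0) \<epsilon> = ?h \<epsilon>"
    using eventually_at_right_less[of 0] by eventually_elim (simp only: eq)
  from Lim_transform_eventually[OF pressure_at_scale_tendsto this]
  show ?thesis
    unfolding topological_entropy_def by (rule tendsto_Lim[OF trivial_limit_at_right_real])
qed

lemma continuous_word_sum:
  assumes "set w \<subseteq> {..<m}" "continuous_on X \<phi>"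
  shows "continuous_on X (word_sum f w \<phi>)"
  unfolding word_sum_def
proof (rule continuous_on_sum)
  fix w' assume "w' \<in> {w'. strict_suffix w' w}"
  then have w': "set w' \<subseteq> {..<m}" using assms strict_suffix_set_subset by blast
  show "continuous_on X (\<lambda>x. \<phi> (word_map f w' x))"
    by (rule continuous_on_compose2[OF assms(2) continuous_word_map[OF w']])
      (use word_map_in[OF w'] in auto)
qed

text \<open>An infinite spanning set has infinite weight because continuous functions on \<open>X\<close> are bounded
  below, so lower bounds for \<^const>\<open>Q_word\<close> need to be checked on finite sets only.\<close>

lemma Q_word_geI:
  assumes w: "set w \<subseteq> {..<m}" and \<phi>: "continuous_on X \<phi>"
    and le: "\<And>E. finite E \<Longrightarrow> spanning X f w \<epsilon> E \<Longrightarrow> c \<le> (\<Sum>y\<in>E. exp (word_sum f w \<phi> y))"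
  shows "ennreal c \<le> Q_word X f \<phi> \<epsilon> w"
  unfolding Q_word_def
proof (rule INF_greatest)
  fix E assume "E \<in> {E. spanning X f w \<epsilon> E}"
  then have E: "spanning X f w \<epsilon> E" by simp
  show "ennreal c \<le> (\<Sum>\<^sub>\<infinity>x\<in>E. ennreal (exp (word_sum f w \<phi> x)))"
  proof (cases "finite E")
    case True
    then show ?thesis using le[OF True E] by (simp add: sum_ennreal ennreal_leI)
  next
    case False
    obtain x0 where x0: "\<And>x. x \<in> X \<Longrightarrow> word_sum f w \<phi> x0 \<le> word_sum f w \<phi> x"
      using continuous_attains_inf[OF compact X_nonempty continuous_word_sum[OF w \<phi>]] by blast
    have "(\<Sum>\<^sub>\<infinity>x\<in>E. ennreal (exp (word_sum f w \<phi> x))) = \<infinity>"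
      using False E x0
      by (intro infsum_superconst_infinite_ennreal[where b = "ennreal (exp (word_sum f w \<phi> x0))"])
        (auto simp: spanning_def intro!: ennreal_leI)
    then show ?thesis by simp
  qed
qed

end

section \<open>The partial variational principle\<close>

context partitioned_system
begin

text \<open>
  Only the lengths that are multiples of \<open>N\<close> are used. This suffices, because the pressure is an upper
  limit in \<open>n\<close> while the normalised entropies converge.
\<close>

lemma pressure_at_scale_ge:
  fixes \<tau> :: real
  assumes K: "\<And>u a. u \<in> words m N \<Longrightarrow> a \<in> labels N \<Longrightarrow> compact (K u a) \<and> K u a \<subseteq> cylinder u a"
    and small: "\<And>u. u \<in> words m N \<Longrightarrow> prob (X - (\<Union>a\<in>labels N. K u a)) * ln (card (labels N)) \<le> 1"
    and sep: "\<forall>u\<in>words m N. \<forall>a\<in>labels N. \<forall>b\<in>labels N. a \<noteq> b \<longrightarrow>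
      (\<forall>x\<in>K u a. \<forall>y\<in>K u b. 2 * \<epsilon> \<le> dist x y)"
    and N: "N \<ge> 1" and \<phi>: "continuous_on X \<phi>"
    and osc: "\<And>x y. x \<in> X \<Longrightarrow> y \<in> X \<Longrightarrow> dist x y < \<epsilon> \<Longrightarrow> \<phi> x - \<phi> y \<le> \<tau>"
  shows "ereal (measure_entropy_wrt \<mu> m f \<xi> + (\<integral>x. \<phi> x \<partial>\<mu>) - \<tau> - (1 + ln 2) / N)
    \<le> pressure_at_scale X m f \<phi> \<epsilon>"
proof -
  let ?I = "\<integral>x. \<phi> x \<partial>\<mu>"
  let ?r = "\<lambda>q. Suc q * N"
  define p where "p n = ereal (1 / real n) * ln_ennreal (Q_level X m f \<phi> \<epsilon> n)" for n
  define b where "b n = mean_entropy n / n + ?I - \<tau> - (1 + ln 2) / N" for n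
  have mono: "strict_mono ?r" using N by (intro strict_monoI) auto
  have bp: "ereal (b (?r q)) \<le> p (?r q)" for q
  proof -
    let ?n = "?r q"
    \<comment> \<open>\<open>exp (L w)\<close> is the lower bound of the central estimate for \<open>Q_word\<close>, and \<open>b ?n\<close> is the average of \<open>L\<close>
      divided by the length \<open>?n\<close>.\<close>
    define L where "L w = entropy_along w + (?n * ?I - ?n * \<tau> - Suc q * (1 + ln 2))" for w
    have n: "real ?n > 0" using N by (simp only: of_nat_0_less_iff) simp
    have "ennreal (exp (L w)) \<le> Q_word X f \<phi> \<epsilon> w" if w: "w \<in> words m ?n" for w
    proof (rule Q_word_geI[OF _ \<phi>])
      fix E assume E: "finite E" "spanning X f w \<epsilon> E"
      then have "E \<noteq> {}" using X_nonempty by (auto simp: spanning_def)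
      then have "(\<Sum>y\<in>E. exp (word_sum f w \<phi> y)) > 0" using E by (intro sum_pos) auto
      moreover have "L w \<le> ln (\<Sum>y\<in>E. exp (word_sum f w \<phi> y))"
        using entropy_along_le_spanning[OF K small sep N w \<phi> osc E] by (simp add: L_def algebra_simps)
      ultimately show "exp (L w) \<le> (\<Sum>y\<in>E. exp (word_sum f w \<phi> y))"
        by (simp add: ln_ge_iff)
    qed (use w in \<open>simp add: words_def\<close>)
    then have "(\<Sum>w\<in>words m ?n. ennreal (exp (L w))) \<le> (\<Sum>w\<in>words m ?n. Q_word X f \<phi> \<epsilon> w)"
      by (rule sum_mono)
    then have "ennreal (\<Sum>w\<in>words m ?n. exp (L w)) \<le> (\<Sum>w\<in>words m ?n. Q_word X f \<phi> \<epsilon> w)"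
      by (simp add: sum_ennreal)
    then have "ennreal (\<Sum>w\<in>words m ?n. exp (L w)) / of_nat (m ^ ?n) \<le> Q_level X m f \<phi> \<epsilon> ?n"
      unfolding Q_level_def by (rule divide_right_mono_ennreal)
    then have Q: "ennreal ((\<Sum>w\<in>words m ?n. exp (L w)) / real (m ^ ?n)) \<le> Q_level X m f \<phi> \<epsilon> ?n"
      using m_pos by (subst (asm) divide_ennreal_of_nat) (auto intro!: sum_nonneg)
    have card: "real (card (words m ?n)) = real (m ^ ?n)" "real (m ^ ?n) > 0"
      using m_pos by (simp_all add: card_words)
    have "sum L (words m ?n) / real (m ^ ?n) = ?n * b ?n"
    proof -
      have "sum L (words m ?n) = (\<Sum>w\<in>words m ?n. entropy_along w)
          + real (m ^ ?n) * (?n * ?I - ?n * \<tau> - Suc q * (1 + ln 2))"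
        unfolding L_def sum.distrib using card(1) by simp
      then have "sum L (words m ?n) / real (m ^ ?n) =
          mean_entropy ?n + (?n * ?I - ?n * \<tau> - Suc q * (1 + ln 2))"
        using card(2) unfolding mean_entropy_def
        by (simp only: add_divide_distrib of_nat_power) simp
      also have "real (Suc q) * (1 + ln 2) = ?n * ((1 + ln 2) / N)" using N by (simp add: field_simps)
      also have "mean_entropy ?n = ?n * (mean_entropy ?n / ?n)" using n by simp
      finally show ?thesis unfolding b_def by (simp only: algebra_simps)
    qed
    then have "exp (?n * b ?n) \<le> (\<Sum>w\<in>words m ?n. exp (L w)) / real (m ^ ?n)"
      using exp_average_le[OF finite_words words_nonempty, of L ?n] card(1) by simp
    then have "ennreal (exp (?n * b ?n)) \<le> Q_level X m f \<phi> \<epsilon> ?n"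
      using Q by (meson ennreal_leI order_trans)
    from ln_ennreal_mono[OF this] have "ereal (?n * b ?n) \<le> ln_ennreal (Q_level X m f \<phi> \<epsilon> ?n)"
      by (simp add: ln_ennreal_ennreal)
    then have "ereal (1 / real ?n) * ereal (?n * b ?n) \<le> p ?n"
      unfolding p_def by (intro ereal_mult_left_mono) auto
    moreover have "ereal (1 / real ?n) * ereal (?n * b ?n) = ereal (b ?n)"
      using n by (simp del: of_nat_mult of_nat_Suc mult_Suc)
    ultimately show ?thesis by simp
  qed
  have "(\<lambda>q. mean_entropy (?r q) / ?r q) \<longlonglongrightarrow> measure_entropy_wrt \<mu> m f \<xi>"
    using LIMSEQ_subseq_LIMSEQ[OF mean_entropy_tendsto mono] by (simp only: comp_def)
  then have "(\<lambda>q. ereal (b (?r q))) \<longlonglongrightarrow> ereal (measure_entropy_wrt \<mu> m f \<xi> + ?I - \<tau> - (1 + ln 2) / N)"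
    unfolding b_def by (intro tendsto_ereal tendsto_intros)
  then have "ereal (measure_entropy_wrt \<mu> m f \<xi> + ?I - \<tau> - (1 + ln 2) / N) = limsup (\<lambda>q. ereal (b (?r q)))"
    by (intro lim_imp_Limsup[symmetric]) auto
  also have "\<dots> \<le> limsup (p \<circ> ?r)"
    by (intro Limsup_mono always_eventually allI) (use bp in \<open>simp add: comp_def\<close>)
  also have "\<dots> \<le> limsup p" by (rule limsup_subseq_mono[OF mono])
  finally show ?thesis unfolding p_def pressure_at_scale_def .
qed

text \<open>
  The loss in the previous estimate is arbitrarily small: \<open>N\<close> is taken large first, which fixes the
  compact sets, and then \<open>\<epsilon>\<close> is taken small enough for these sets and for the oscillation of \<open>\<phi>\<close>.
\<close>

lemma measure_entropy_wrt_le_pressure: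
  assumes \<phi>: "continuous_on X \<phi>"
  shows "ereal (measure_entropy_wrt \<mu> m f \<xi> + (\<integral>x. \<phi> x \<partial>\<mu>)) \<le> pressure X m f \<phi>"
proof (rule ereal_le_epsilon2)
  fix \<tau> :: real assume \<tau>: "\<tau> > 0"
  let ?h = "measure_entropy_wrt \<mu> m f \<xi> + (\<integral>x. \<phi> x \<partial>\<mu>)"
  obtain N :: nat where N: "2 * (1 + ln 2) / \<tau> < N" using reals_Archimedean2 by blast
  have "0 < 2 * (1 + ln 2) / \<tau>" using \<tau> by (simp add: add_pos_pos)
  then have N1: "N \<ge> 1" and Nr: "real N > 0" using N by (auto simp: Suc_le_eq intro: gr0I)
  then have small: "(1 + ln 2) / N \<le> \<tau> / 2" using N \<tau> by (simp add: field_simps)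
  obtain K where K: "\<And>u a. u \<in> words m N \<Longrightarrow> a \<in> labels N \<Longrightarrow> compact (K u a) \<and> K u a \<subseteq> cylinder u a"
    "\<And>u. u \<in> words m N \<Longrightarrow> prob (X - (\<Union>a\<in>labels N. K u a)) * ln (card (labels N)) \<le> 1"
    using compact_approximation_of_cylinders[of N] by blast
  have "uniformly_continuous_on X \<phi>" using compact_uniformly_continuous \<phi> compact by blast
  then obtain d where d: "d > 0" "\<And>x y. x \<in> X \<Longrightarrow> y \<in> X \<Longrightarrow> dist x y < d \<Longrightarrow> dist (\<phi> x) (\<phi> y) < \<tau> / 2"
    unfolding uniformly_continuous_on_def using \<tau> by (metis half_gt_zero)
  have "\<forall>\<^sub>F \<epsilon> in at_right 0. \<epsilon> < d"
    using d(1) by (intro order_tendstoD[OF tendsto_ident_at]) simp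
  moreover have "\<forall>\<^sub>F \<epsilon> in at_right 0. \<forall>u\<in>words m N. \<forall>a\<in>labels N. \<forall>b\<in>labels N. a \<noteq> b \<longrightarrow>
    (\<forall>x\<in>K u a. \<forall>y\<in>K u b. 2 * \<epsilon> \<le> dist x y)"
    by (rule eventually_separated[OF K(1)])
  ultimately have "\<forall>\<^sub>F \<epsilon> in at_right 0. ereal (?h - \<tau>) \<le> pressure_at_scale X m f \<phi> \<epsilon>"
  proof eventually_elim
    case (elim \<epsilon>)
    have "\<phi> x - \<phi> y \<le> \<tau> / 2" if "x \<in> X" "y \<in> X" "dist x y < \<epsilon>" for x y
      using d(2)[OF that(1,2)] that(3) elim(1) unfolding dist_real_def by linarith
    from pressure_at_scale_ge[OF K elim(2) N1 \<phi> this]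
    have "ereal (?h - \<tau> / 2 - (1 + ln 2) / N) \<le> pressure_at_scale X m f \<phi> \<epsilon>" by simp
    then show ?case
      by (rule order_trans[rotated]) (unfold ereal_less_eq, use small in linarith)
  qed
  then have "ereal (?h - \<tau>) \<le> pressure X m f \<phi>"
    by (rule tendsto_lowerbound[OF pressure_at_scale_tendsto _ trivial_limit_at_right_real])
  then show "ereal ?h \<le> pressure X m f \<phi> + ereal \<tau>"
    by (cases "pressure X m f \<phi>") auto
qed

end

lemma (in invariant_system) measure_entropy_le_pressure:
  assumes \<phi>: "continuous_on X \<phi>"
  shows "measure_entropy \<mu> m f + ereal (\<integral>x. \<phi> x \<partial>\<mu>) \<le> pressure X m f \<phi>"
proof -
  let ?P = "pressure X m f \<phi>" and ?I = "\<integral>x. \<phi> x \<partial>\<mu>"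
  have "measure_entropy \<mu> m f \<le> ?P - ereal ?I"
    unfolding measure_entropy_def
  proof (rule SUP_least)
    fix \<xi> assume "\<xi> \<in> finite_partitions \<mu>"
    then interpret partitioned_system X m f \<mu> \<xi> by unfold_locales
    show "ereal (measure_entropy_wrt \<mu> m f \<xi>) \<le> ?P - ereal ?I"
      using measure_entropy_wrt_le_pressure[OF \<phi>] by (cases ?P) auto
  qed
  then show ?thesis by (cases ?P; cases "measure_entropy \<mu> m f") auto
qed

theorem theorem1p2:
  fixes X :: "'a::metric_space set"
    and m :: nat
    and f :: "nat \<Rightarrow> 'a \<Rightarrow> 'a"
    and \<phi> :: "'a \<Rightarrow> real"
  assumes "m \<ge> 1"
    and "compact X"
    and "\<And>i. i < m \<Longrightarrow> f i \<in> X \<rightarrow> X"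
    and "\<And>i. i < m \<Longrightarrow> continuous_on X (f i)"
    and "invariant_measures X m f \<noteq> {}"
    and "continuous_on X \<phi>"
  shows "(SUP \<mu> \<in> invariant_measures X m f. measure_entropy \<mu> m f + ereal (integral\<^sup>L \<mu> \<phi>))
           \<le> pressure X m f \<phi>
       \<and> (SUP \<mu> \<in> invariant_measures X m f. measure_entropy \<mu> m f) \<le> topological_entropy X m f"
proof (intro conjI SUP_least)
  fix \<mu> assume \<mu>: "\<mu> \<in> invariant_measures X m f"
  interpret invariant_system X m f \<mu> by unfold_locales (use assms \<mu> in auto)
  show "measure_entropy \<mu> m f + ereal (integral\<^sup>L \<mu> \<phi>) \<le> pressure X m f \<phi>"
    by (rule measure_entropy_le_pressure[OF assms(6)])
  show "measure_entropy \<mu> m f \<le> topological_entropy X m f"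
    using measure_entropy_le_pressure[of "\<lambda>_. 0"] by (simp add: topological_entropy_eq_pressure_zero)
qed

end
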